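(* Let $0<\alpha<2$. (a) Let $\sigma$ be a finite symmetric measure on $S^{d-1}$ not concentrated on any $(d-1)$-dimensional subspace of $\mathbb{R}^d$, and for $\lambda\ge0$ let $\mathbb{M}_\lambda$ be the associated $\mathbb{R}^d$-valued independently scattered random measure on $\mathbb{R}^n$ (exponentially tempered stable for $\lambda>0$, symmetric $\alpha$-stable for $\lambda=0$). Let $E\in Q(\mathbb{R}^n)$ with trace $q$, let $\varphi:\mathbb{R}^n\to[0,\infty)$ be $E$-homogeneous and $(\beta,E)$-admissible for some $\beta>0$, and let $D\in Q(\mathbb{R}^d)$ be such that the maximum $H$ of the real parts of the eigenvalues of $D$ fulfills $H<\beta$. For $\lambda\ge0$ let $\mathbb{X}_\lambda=\{X_\lambda(t):t\in\mathbb{R}^n\}$ with $$X_\lambda(t)=\int_{\mathbb{R}^n}\left[\varphi(t-s)^{D-\frac q\alpha I}-\varphi(-s)^{D-\frac q\alpha I}\right]\mathbb{M}_\lambda(ds).$$ Then, as $\lambda\to0$, the finite-dimensional distributions of $\mathbb{X}_\lambda$ converge to those of $\mathbb{X}_0$. (b) Let $\tilde\sigma$ be a finite symmetric measure on $S^{2d-1}$ not concentrated on any $(2d-1)$-dimensional subspace of $\mathbb{R}^{2d}$, and for $\lambda\ge0$ let $\mathbb{M}_\lambda^{\mathbb{C}}$ be the associated $\mathbb{C}^d$-valued independently scattered random measure on $\mathbb{R}^n$. Let $E\in Q(\mathbb{R}^n)$ with trace $q$ and smallest real part of its eigenvalues $a$, let $\varphi:\mathbb{R}^n\to[0,\infty)$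 be continuous and $E^*$-homogeneous with $\varphi(x)>0$ for all $x\ne0$, and let $D\in Q(\mathbb{R}^d)$ be such that the maximum $H$ of the real parts of the eigenvalues of $D$ fulfills $H<a$. For $\lambda\ge0$ let $\mathbb{Y}_\lambda=\{Y_\lambda(t):t\in\mathbb{R}^n\}$ with $$Y_\lambda(t)=\operatorname{Re}\int_{\mathbb{R}^n}\left(e^{\mathrm{i}\langle t,s\rangle}-1\right)\varphi(s)^{-D-\frac q\alpha I}\,\mathbb{M}_\lambda^{\mathbb{C}}(ds).$$ Then, as $\lambda\to0$, the finite-dimensional distributions of $\mathbb{Y}_\lambda$ converge to those of $\mathbb{Y}_0$.
   Context: Notation: $L(\mathbb{R}^m)$ is the space of real $m\times m$ matrices, $I=I_d$ the identity on $\mathbb{R}^d$, $E^*$ the adjoint (transpose), $\|\cdot\|$ the Euclidean norm. $Q(\mathbb{R}^m)$ is the set of $E\in L(\mathbb{R}^m)$ all of whose eigenvalues have strictly positive real part. For $c>0$ and a matrix $B$, $c^B:=\exp((\log c)B)$. For $E\in Q(\mathbb{R}^n)$ there is a norm $\|\cdot\|_E$ on $\mathbb{R}^n$ such that, with $S_E^{n-1}=\{x:\|x\|_E=1\}$, the map $(0,\infty)\times S_E^{n-1}\to\mathbb{R}^n\setminus\{0\}$, $(c,\theta)\mapsto c^E\theta$, is a homeomorphism; fix such a norm and write $x=\tau(x)^El(x)$ with $\tau(x)>0$, $l(x)\in S_E^{n-1}$ for $x\ne0$; $\tau(0)=0$. A function $\varphi$ on $\mathbb{R}^n$ is $E$-homogeneous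 if $\varphi(c^Ex)=c\,\varphi(x)$ for all $c>0$, $x\ne0$ (analogously $E^*$-homogeneous). $\varphi:\mathbb{R}^n\to[0,\infty)$ is $(\beta,E)$-admissible ($\beta>0$) if (i) $\varphi(x)>0$ for all $x\ne0$, and (ii) $\varphi$ is continuous and for any $0<A<B$ there is $C>0$ such that for $A\le\|y\|\le B$: $\tau(x)\le1\Rightarrow|\varphi(x+y)-\varphi(y)|\le C\tau(x)^\beta$. Random measures: for $\lambda\ge0$ let $\phi_\lambda(A)=\int_{S^{d-1}}\int_0^\infty\mathbf{1}_A(r\theta)r^{-\alpha-1}e^{-\lambda r}\,dr\,\sigma(d\theta)$ and $\psi_\lambda(u)=\int_{\mathbb{R}^d}(\cos\langle u,x\rangle-1)\phi_\lambda(dx)$. $\mathbb{M}_\lambda$ is a family of $\mathbb{R}^d$-valued random vectors $\mathbb{M}_\lambda(A)$, indexed by Borel sets $A\subset\mathbb{R}^n$ of finite Lebesgue measure $|A|$, independent over disjoint sets, a.s. $\sigma$-additive over disjoint sequences whose union has finite measure, with $\mathbb{M}_\lambda(A)$ having log-characteristic function $|A|\psi_\lambda$. $\tilde\phi_\lambda$, $\tilde\psi_\lambda$ and the $\mathbb{R}^{2d}$-valued $\widetilde{\mathbb{M}}_\lambda$ are defined in the same way with $2d$, $\tilde\sigma$ in place of $d$, $\sigma$; $\mathbb{M}_\lambda^{\mathbb{C}}$ is obtained from $\widetilde{\mathbb{M}}_\lambda$ by identifying $\mathbb{R}^{2d}$ with $\mathbb{C}^d$ (first $d$ coordinates real part,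 last $d$ imaginary part). Stochastic integral: for simple $f=\sum_jD_j\mathbf{1}_{A_j}$ put $I(f)=\sum_jD_j\mathbb{M}_\lambda(A_j)$. A measurable $f:\mathbb{R}^n\to L(\mathbb{R}^d)$ belongs to $\mathcal{I}(\mathbb{M}_\lambda)$ if there are simple $f_k\to f$ a.e. such that $I(f_k\mathbf{1}_A)$ converges in probability for every Borel $A$; then $I(f)=\int f\,d\mathbb{M}_\lambda=\lim I(f_k)$. Known facts: $f\in\mathcal{I}(\mathbb{M}_\lambda)$ iff $\int_{\mathbb{R}^n}\int_{\mathbb{R}^d}(1\wedge\|f(s)x\|^2)\phi_\lambda(dx)ds<\infty$ (may be taken as the definition); $I$ is linear; $(I(f_1),\dots,I(f_k))^t$ has log-characteristic function $(u_1,\dots,u_k)^t\mapsto\int_{\mathbb{R}^n}\psi_\lambda(\sum_jf_j(s)^*u_j)ds$. The same applies to $\widetilde{\mathbb{M}}_\lambda$. For measurable $g:\mathbb{R}^n\to L(\mathbb{C}^d)$, $\operatorname{Re}\int g\,d\mathbb{M}_\lambda^{\mathbb{C}}$ exists iff $\tilde g:=\begin{pmatrix}\operatorname{Re}g&-\operatorname{Im}g\\0&0\end{pmatrix}\in\mathcal{I}(\widetilde{\mathbb{M}}_\lambda)$, and then it is the vector of the first $d$ coordinates of $\int\tilde g\,d\widetilde{\mathbb{M}}_\lambda$. Integrands need only be defined for Lebesgue-a.e. $s$. Under the stated hypotheses, all the integrals defining $X_\lambda(t)$ and $Y_\lambda(t)$, $\lambda\ge0$, exist. *)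

theory Defs
  imports "HOL-Probability.Probability"
begin

section \<open>Matrices\<close>

definition eigvals :: "real^'m^'m \<Rightarrow> complex set" where
  "eigvals A = {z. \<exists>v::complex^'m. v \<noteq> 0 \<and> (\<chi> i j. complex_of_real (A $ i $ j)) *v v = z *s v}"

definition matQ :: "(real^'m^'m) set" where
  "matQ = {A. \<forall>z\<in>eigvals A. 0 < Re z}"

text \<open>The class operations \<open>*\<close>, \<open>^\<close> and \<open>1\<close> on the type of matrices are componentwise, hence the
  powers with respect to the matrix product.\<close>

primrec mat_power :: "real^'m^'m \<Rightarrow> nat \<Rightarrow> real^'m^'m" where
  "mat_power A 0 = mat 1"
| "mat_power A (Suc k) = A ** mat_power A k"

definition mat_exp :: "real^'m^'m \<Rightarrow> real^'m^'m" where
  "mat_exp A = (\<Sum>k. mat_power A k /\<^sub>R fact k)"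

definition mat_pow :: "real \<Rightarrow> real^'m^'m \<Rightarrow> real^'m^'m" where
  "mat_pow c B = mat_exp (ln c *\<^sub>R B)"


section \<open>Homogeneous and admissible functions\<close>

definition is_norm :: "('a::real_vector \<Rightarrow> real) \<Rightarrow> bool" where
  "is_norm N \<longleftrightarrow> (\<forall>x. 0 \<le> N x) \<and> (\<forall>x. N x = 0 \<longleftrightarrow> x = 0) \<and>
     (\<forall>c x. N (c *\<^sub>R x) = \<bar>c\<bar> * N x) \<and> (\<forall>x y. N (x + y) \<le> N x + N y)"

definition polar_norm :: "real^'n^'n \<Rightarrow> (real^'n \<Rightarrow> real) \<Rightarrow> bool" where
  "polar_norm E N \<longleftrightarrow> is_norm N \<and>
     (\<exists>g. homeomorphism ({0<..} \<times> {\<theta>. N \<theta> = 1}) (UNIV - {0}) (\<lambda>(c, \<theta>). mat_pow c E *v \<theta>) g)"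

definition polar_radius :: "real^'n^'n \<Rightarrow> (real^'n \<Rightarrow> real) \<Rightarrow> real^'n \<Rightarrow> real" where
  "polar_radius E N x =
     (if x = 0 then 0 else (THE c. 0 < c \<and> (\<exists>\<theta>. N \<theta> = 1 \<and> x = mat_pow c E *v \<theta>)))"

definition homogeneous :: "real^'n^'n \<Rightarrow> (real^'n \<Rightarrow> real) \<Rightarrow> bool" where
  "homogeneous E \<phi> \<longleftrightarrow> (\<forall>c x. 0 < c \<longrightarrow> x \<noteq> 0 \<longrightarrow> \<phi> (mat_pow c E *v x) = c * \<phi> x)"

definition admissible :: "real \<Rightarrow> real^'n^'n \<Rightarrow> (real^'n \<Rightarrow> real) \<Rightarrow> (real^'n \<Rightarrow> real) \<Rightarrow> bool" where
  "admissible \<beta> E N \<phi> \<longleftrightarrow>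
     (\<forall>x. x \<noteq> 0 \<longrightarrow> 0 < \<phi> x) \<and> continuous_on UNIV \<phi> \<and>
     (\<forall>A B. 0 < A \<longrightarrow> A < B \<longrightarrow> (\<exists>C>0. \<forall>x y. A \<le> norm y \<longrightarrow> norm y \<le> B \<longrightarrow>
        polar_radius E N x \<le> 1 \<longrightarrow> \<bar>\<phi> (x + y) - \<phi> y\<bar> \<le> C * polar_radius E N x powr \<beta>))"


section \<open>Tempered stable Levy measures\<close>

definition spectral_measure :: "(real^'d) measure \<Rightarrow> bool" where
  "spectral_measure \<sigma> \<longleftrightarrow>
     sets \<sigma> = sets (restrict_space borel (sphere 0 1)) \<and> finite_measure \<sigma> \<and>
     (\<forall>A\<in>sets \<sigma>. emeasure \<sigma> (uminus ` A) = emeasure \<sigma> A) \<and>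
     (\<forall>V. subspace V \<longrightarrow> dim V + 1 = CARD('d) \<longrightarrow> 0 < emeasure \<sigma> (space \<sigma> - V))"

definition levy_content :: "real \<Rightarrow> (real^'d) measure \<Rightarrow> real \<Rightarrow> (real^'d) set \<Rightarrow> ennreal" where
  "levy_content \<alpha> \<sigma> l A = (\<integral>\<^sup>+\<theta>. (\<integral>\<^sup>+r\<in>{0<..}.
      indicator A (r *\<^sub>R \<theta>) * ennreal (r powr (-\<alpha> - 1) * exp (- l * r)) \<partial>lborel) \<partial>\<sigma>)"

definition levy_measure :: "real \<Rightarrow> (real^'d) measure \<Rightarrow> real \<Rightarrow> (real^'d) measure" where
  "levy_measure \<alpha> \<sigma> l = measure_of UNIV (sets borel) (levy_content \<alpha> \<sigma> l)"

lemma sets_levy_measure [simp]: "sets (levy_measure \<alpha> \<sigma> l) = sets borel"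
  unfolding levy_measure_def
  by (metis sets.sigma_sets_eq sets_measure_of space_borel subset_Pow_Union top_greatest Pow_UNIV)

lemma space_levy_measure [simp]: "space (levy_measure \<alpha> \<sigma> l) = UNIV"
  by (simp add: levy_measure_def space_measure_of_conv)

text \<open>The set function is countably additive, so \<open>measure_of\<close> does not degenerate.\<close>

lemma emeasure_levy_measure:
  fixes \<sigma> :: "(real^'d) measure"
  assumes "spectral_measure \<sigma>" "A \<in> sets borel"
  shows "emeasure (levy_measure \<alpha> \<sigma> l) A = levy_content \<alpha> \<sigma> l A"
proof -
  have sets_\<sigma>: "sets \<sigma> = sets (restrict_space borel (sphere 0 1))"
    using assms(1) by (simp add: spectral_measure_def)
  have id_meas [measurable]: "(\<lambda>x. x) \<in> measurable \<sigma> borel"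
    by (simp add: measurable_cong_sets[OF sets_\<sigma> refl] measurable_restrict_space1)
  have outer: "(\<lambda>\<theta>. \<integral>\<^sup>+r\<in>{0<..}. indicator B (r *\<^sub>R \<theta>) *
      ennreal (r powr (-\<alpha> - 1) * exp (- l * r)) \<partial>lborel) \<in> borel_measurable \<sigma>"
    if [measurable]: "B \<in> sets borel" for B :: "(real^'d) set"
    by (intro lborel.borel_measurable_nn_integral) measurable
  have "positive (sets borel) (levy_content \<alpha> \<sigma> l)"
    by (simp add: positive_def levy_content_def)
  moreover have "countably_additive (sets borel) (levy_content \<alpha> \<sigma> l)"
  proof (rule countably_additiveI)
    fix B :: "nat \<Rightarrow> (real^'d) set"
    assume B: "range B \<subseteq> sets borel" "disjoint_family B"
    then have [measurable]: "B i \<in> sets borel" for i by auto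
    have ind: "(\<Sum>i. indicator (B i) x) = (indicator (\<Union>i. B i) x :: ennreal)" for x
      by (rule suminf_indicator[OF B(2)])
    show "(\<Sum>i. levy_content \<alpha> \<sigma> l (B i)) = levy_content \<alpha> \<sigma> l (\<Union>i. B i)"
      unfolding levy_content_def ind[symmetric]
      by (simp add: nn_integral_suminf[symmetric] outer ennreal_suminf_multc[symmetric]
          mult.assoc del: ennreal_suminf_multc)
  qed
  ultimately show ?thesis
    unfolding levy_measure_def using assms(2)
    by (metis emeasure_measure_of_sigma sets.sigma_algebra_axioms space_borel)
qed

definition levy_psi :: "real \<Rightarrow> (real^'d) measure \<Rightarrow> real \<Rightarrow> real^'d \<Rightarrow> real" where
  "levy_psi \<alpha> \<sigma> l u = (\<integral>x. cos (u \<bullet> x) - 1 \<partial>levy_measure \<alpha> \<sigma> l)"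


section \<open>Independently scattered random measures and stochastic integrals\<close>

definition fin_borel :: "(real^'n) set set" where
  "fin_borel = {A \<in> sets borel. emeasure lborel A < \<infinity>}"

definition random_measure ::
  "'w measure \<Rightarrow> (real^'d \<Rightarrow> real) \<Rightarrow> ((real^'n) set \<Rightarrow> 'w \<Rightarrow> real^'d) \<Rightarrow> bool" where
  "random_measure P \<psi> M \<longleftrightarrow>
     prob_space P \<and>
     (\<forall>A\<in>fin_borel. M A \<in> borel_measurable P) \<and>
     (\<forall>A::nat \<Rightarrow> (real^'n) set. range A \<subseteq> fin_borel \<longrightarrow> disjoint_family A \<longrightarrow>
        prob_space.indep_vars P (\<lambda>_. borel) (\<lambda>i. M (A i)) UNIV) \<and>
     (\<forall>A::nat \<Rightarrow> (real^'n) set. range A \<subseteq> fin_borel \<longrightarrow> disjoint_family A \<longrightarrow>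
        (\<Union>i. A i) \<in> fin_borel \<longrightarrow> (AE \<omega> in P. (\<lambda>i. M (A i) \<omega>) sums M (\<Union>i. A i) \<omega>)) \<and>
     (\<forall>A\<in>fin_borel. \<forall>u. (CLINT \<omega>|P. iexp (u \<bullet> M A \<omega>)) =
        exp (complex_of_real (measure lborel A * \<psi> u)))"

definition conv_in_prob ::
  "'w measure \<Rightarrow> (nat \<Rightarrow> 'w \<Rightarrow> 'a::real_normed_vector) \<Rightarrow> ('w \<Rightarrow> 'a) \<Rightarrow> bool" where
  "conv_in_prob P X Y \<longleftrightarrow>
     (\<forall>\<epsilon>>0. (\<lambda>k. measure P {\<omega> \<in> space P. \<epsilon> < norm (X k \<omega> - Y \<omega>)}) \<longlonglongrightarrow> 0)"

text \<open>The integral of a simple function, in its canonical representation. The simple functions are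
  those satisfying \<open>simple_bochner_integrable lborel\<close>: finitely many values, each
  non-zero one being taken on a Borel set of finite measure.\<close>

definition simple_stoch_integral ::
  "((real^'n) set \<Rightarrow> 'w \<Rightarrow> real^'d) \<Rightarrow> (real^'n \<Rightarrow> real^'d^'d) \<Rightarrow> 'w \<Rightarrow> real^'d" where
  "simple_stoch_integral M f \<omega> = (\<Sum>D\<in>range f - {0}. D *v M (f -` {D}) \<omega>)"

text \<open>\<open>has_stoch_integral P M f X\<close>: the function \<open>f\<close> is integrable with respect to \<open>M\<close>, and the
  random vector \<open>X\<close> is a version of its integral (which is unique only up to null sets).\<close>

definition has_stoch_integral ::
  "'w measure \<Rightarrow> ((real^'n) set \<Rightarrow> 'w \<Rightarrow> real^'d) \<Rightarrow> (real^'n \<Rightarrow> real^'d^'d) \<Rightarrow> ('w \<Rightarrow> real^'d) \<Rightarrow> bool"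
  where
  "has_stoch_integral P M f X \<longleftrightarrow>
     f \<in> borel_measurable lborel \<and> X \<in> borel_measurable P \<and>
     (\<exists>F. (\<forall>k. Bochner_Integration.simple_bochner_integrable lborel (F k)) \<and>
          (AE s in lborel. (\<lambda>k. F k s) \<longlonglongrightarrow> f s) \<and>
          (\<forall>A\<in>sets borel. \<exists>Y\<in>borel_measurable P.
             conv_in_prob P (\<lambda>k. simple_stoch_integral M (\<lambda>s. indicator A s *\<^sub>R F k s)) Y) \<and>
          conv_in_prob P (\<lambda>k. simple_stoch_integral M (F k)) X)"

text \<open>The space of real \<open>2d\<close>-vectors is rendered with the index type \<open>'d + 'd\<close>: the left summand
  holds the first \<open>d\<close> coordinates (real part), the right one the last \<open>d\<close> (imaginary part).\<close>

definition realify :: "complex^'d \<Rightarrow> real^('d + 'd)" where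
  "realify z = (\<chi> i. case i of Inl j \<Rightarrow> Re (z $ j) | Inr j \<Rightarrow> Im (z $ j))"

definition block_mat :: "complex^'d^'d \<Rightarrow> real^('d + 'd)^('d + 'd)" where
  "block_mat G = (\<chi> i j. case i of
       Inl a \<Rightarrow> (case j of Inl b \<Rightarrow> Re (G $ a $ b) | Inr b \<Rightarrow> - Im (G $ a $ b))
     | Inr a \<Rightarrow> 0)"

definition complex_random_measure ::
  "'w measure \<Rightarrow> (real^('d + 'd) \<Rightarrow> real) \<Rightarrow> ((real^'n) set \<Rightarrow> 'w \<Rightarrow> complex^'d) \<Rightarrow> bool" where
  "complex_random_measure P \<psi> MC \<longleftrightarrow> random_measure P \<psi> (\<lambda>A \<omega>. realify (MC A \<omega>))"

definition has_Re_stoch_integral ::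
  "'w measure \<Rightarrow> ((real^'n) set \<Rightarrow> 'w \<Rightarrow> complex^'d) \<Rightarrow> (real^'n \<Rightarrow> complex^'d^'d) \<Rightarrow>
     ('w \<Rightarrow> real^'d) \<Rightarrow> bool" where
  "has_Re_stoch_integral P MC g X \<longleftrightarrow>
     (\<exists>Z. has_stoch_integral P (\<lambda>A \<omega>. realify (MC A \<omega>)) (\<lambda>s. block_mat (g s)) Z \<and>
          X = (\<lambda>\<omega>. \<chi> i. Z \<omega> $ Inl i))"


section \<open>Kernels\<close>

text \<open>At the single points where the argument of \<open>mat_pow\<close> vanishes the kernels take an irrelevant
  value.\<close>

definition ma_kernel ::
  "real \<Rightarrow> real^'n^'n \<Rightarrow> (real^'n \<Rightarrow> real) \<Rightarrow> real^'d^'d \<Rightarrow> real^'n \<Rightarrow> real^'n \<Rightarrow> real^'d^'d" where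
  "ma_kernel \<alpha> E \<phi> D t s =
     mat_pow (\<phi> (t - s)) (D - (trace E / \<alpha>) *\<^sub>R mat 1) -
     mat_pow (\<phi> (- s)) (D - (trace E / \<alpha>) *\<^sub>R mat 1)"

definition harm_kernel ::
  "real \<Rightarrow> real^'n^'n \<Rightarrow> (real^'n \<Rightarrow> real) \<Rightarrow> real^'d^'d \<Rightarrow> real^'n \<Rightarrow> real^'n \<Rightarrow> complex^'d^'d" where
  "harm_kernel \<alpha> E \<phi> D t s =
     (\<chi> i j. (iexp (t \<bullet> s) - 1) *
        complex_of_real (mat_pow (\<phi> s) (- D - (trace E / \<alpha>) *\<^sub>R mat 1) $ i $ j))"


section \<open>Convergence of finite-dimensional distributions\<close>

text \<open>Weak convergence of the laws of \<open>(X\<^sub>l(t\<^sub>0), \<dots>, X\<^sub>l(t\<^sub>k\<^sub>-\<^sub>1))\<close> for all \<open>k\<close> and all choices of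
  the times, tested against bounded continuous functions. The processes may live on different
  probability spaces.\<close>

definition fdd_converge ::
  "('l \<Rightarrow> 'w measure) \<Rightarrow> ('l \<Rightarrow> 't \<Rightarrow> 'w \<Rightarrow> 'a::topological_space) \<Rightarrow>
     'v measure \<Rightarrow> ('t \<Rightarrow> 'v \<Rightarrow> 'a) \<Rightarrow> 'l filter \<Rightarrow> bool" where
  "fdd_converge P X P' X' F \<longleftrightarrow>
     (\<forall>(k::nat) (t::nat \<Rightarrow> 't) (h::(nat \<Rightarrow> 'a) \<Rightarrow> real).
        continuous_map (product_topology (\<lambda>_. euclidean) {..<k}) euclideanreal h \<longrightarrow>
        bounded (h ` ({..<k} \<rightarrow>\<^sub>E UNIV)) \<longrightarrow>
        ((\<lambda>l. \<integral>\<omega>. h (\<lambda>i\<in>{..<k}. X l (t i) \<omega>) \<partial>P l) \<longlongrightarrow>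
           (\<integral>\<omega>. h (\<lambda>i\<in>{..<k}. X' (t i) \<omega>) \<partial>P')) F)"

end

theory Submission
  imports Defs
begin

text \<open>The joint characteristic function of the integrals of \<open>f\<^sub>1, \<dots>, f\<^sub>k\<close> at \<open>u\<^sub>1, \<dots>, u\<^sub>k\<close> is
  \<open>exp (\<integral> \<psi>\<^sub>l (f\<^sub>1(s)\<^sup>T u\<^sub>1 + \<dots> + f\<^sub>k(s)\<^sup>T u\<^sub>k) ds)\<close>. The Levy measure for \<open>l\<close> has density
  \<open>exp (- l |x|)\<close> with respect to the one for \<open>0\<close>, hence \<open>|\<psi>\<^sub>l| \<le> |\<psi>\<^sub>0|\<close> and \<open>\<psi>\<^sub>l\<close> converges to
  \<open>\<psi>\<^sub>0\<close> pointwise; dominated convergence and the continuity theorem for characteristic functions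
  conclude. For the complex case the real parts are a continuous image of the integrals in
  dimension \<open>2d\<close>.\<close>

section \<open>The Levy exponent\<close>

text \<open>Integrals are defined as limits in probability along simple functions that converge
  almost everywhere, and the definition supplies no function dominating them. So the formula for
  characteristic functions cannot be carried over from simple integrands by dominated convergence;
  the missing control has to be recovered from the probabilistic side. A difference of two integrals
  has a characteristic function \<open>exp (- d)\<close>, where \<open>d\<close> is the integral of
  -\<psi> over the difference of the integrands. Convergence in probability pushes this value to 1
  and hence \<open>d\<close> to 0. To return from differences to \<psi> of the integrands
  themselves, one needs |\<psi> a - \<psi> b| \<le> - \<epsilon> \<psi> b - (1 + 1/\<epsilon>)
  \<psi> (a - b), which is linear in \<psi> and can therefore be integrated over s. It also yields
  integrability of \<psi> along the limit integrand, and for l = 0 this is the majorant that the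
  limit l to 0 asks for. In the continuity theorem, the one-dimensional theorem of Levy serves only
  for tightness, one coordinate at a time; the limit itself is identified by trigonometric
  polynomials.\<close>

lemma nn_integral_levy_measure:
  fixes \<sigma> :: "(real^'d) measure"
  assumes \<sigma>: "spectral_measure \<sigma>" and f [measurable]: "f \<in> borel_measurable borel"
  shows "(\<integral>\<^sup>+x. f x \<partial>levy_measure \<alpha> \<sigma> l) =
    (\<integral>\<^sup>+\<theta>. (\<integral>\<^sup>+r\<in>{0<..}. f (r *\<^sub>R \<theta>) * ennreal (r powr (-\<alpha> - 1) * exp (- l * r)) \<partial>lborel) \<partial>\<sigma>)"
proof -
  have sets_\<sigma>: "sets \<sigma> = sets (restrict_space borel (sphere 0 1))"
    using \<sigma> by (simp add: spectral_measure_def)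
  interpret \<sigma>: finite_measure \<sigma> using \<sigma> by (simp add: spectral_measure_def)
  have [measurable]: "(\<lambda>x. x) \<in> measurable \<sigma> borel"
    by (simp add: measurable_cong_sets[OF sets_\<sigma> refl] measurable_restrict_space1)
  define w where "w r = ennreal (r powr (-\<alpha> - 1) * exp (- l * r)) * indicator {0<..} r" for r :: real
  have [measurable]: "w \<in> borel_measurable borel" unfolding w_def by measurable
  \<comment> \<open>The polar product measure, pushed forward by multiplication of radius and
    direction. Its integration formula is change of variables plus Tonelli; on indicators it reduces
    to \<open>levy_content\<close>, which identifies it with the Levy measure.\<close>
  define N where "N = distr (density (\<sigma> \<Otimes>\<^sub>M lborel) (\<lambda>(\<theta>, r). w r)) borel (\<lambda>(\<theta>, r). r *\<^sub>R \<theta>)"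
  have N: "(\<integral>\<^sup>+x. g x \<partial>N) = (\<integral>\<^sup>+\<theta>. (\<integral>\<^sup>+r. w r * g (r *\<^sub>R \<theta>) \<partial>lborel) \<partial>\<sigma>)"
    if [measurable]: "g \<in> borel_measurable borel" for g
  proof -
    have "(\<integral>\<^sup>+x. g x \<partial>N) = (\<integral>\<^sup>+z. (case z of (\<theta>, r) \<Rightarrow> w r * g (r *\<^sub>R \<theta>)) \<partial>(\<sigma> \<Otimes>\<^sub>M lborel))"
    proof -
      have mw: "(\<lambda>(\<theta>, r). w r) \<in> borel_measurable (\<sigma> \<Otimes>\<^sub>M lborel)"
        and ms: "(\<lambda>(\<theta>, r). r *\<^sub>R \<theta>) \<in> measurable (\<sigma> \<Otimes>\<^sub>M lborel) borel"
        by measurable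
      have "(\<lambda>z. g ((\<lambda>(\<theta>, r). r *\<^sub>R \<theta>) z)) \<in> borel_measurable (\<sigma> \<Otimes>\<^sub>M lborel)"
        by (rule measurable_compose[OF ms that])
      with mw ms that show ?thesis
        unfolding N_def by (simp add: nn_integral_distr nn_integral_density case_prod_beta)
    qed
    also have "\<dots> = (\<integral>\<^sup>+\<theta>. (\<integral>\<^sup>+r. w r * g (r *\<^sub>R \<theta>) \<partial>lborel) \<partial>\<sigma>)"
    proof -
      have "(\<lambda>(\<theta>, r). w r * g (r *\<^sub>R \<theta>)) \<in> borel_measurable (\<sigma> \<Otimes>\<^sub>M lborel)"
        by measurable
      from lborel.nn_integral_fst[OF this] show ?thesis by simp
    qed
    finally show ?thesis .
  qed
  have "levy_measure \<alpha> \<sigma> l = N"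
  proof (rule measure_eqI)
    fix A assume "A \<in> sets (levy_measure \<alpha> \<sigma> l)"
    then have A [measurable]: "A \<in> sets borel" by simp
    have "A \<in> sets N" by (simp add: N_def)
    then have "emeasure N A = (\<integral>\<^sup>+x. indicator A x \<partial>N)" by simp
    also have "\<dots> = levy_content \<alpha> \<sigma> l A"
      unfolding levy_content_def by (subst N) (auto simp: w_def ac_simps intro!: nn_integral_cong)
    finally show "emeasure (levy_measure \<alpha> \<sigma> l) A = emeasure N A"
      by (simp add: emeasure_levy_measure[OF \<sigma> A])
  qed (simp add: N_def)
  then show ?thesis
    by (simp add: N w_def ac_simps)
qed

text \<open>Since \<sigma> lives on the unit sphere, the radius is recovered from the point as r =
  |r \<theta>|, so the tempering factor becomes a function on the whole space. All parameters l are
  thereby compared over the single measure for l = 0.\<close>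

lemma levy_measure_eq_density:
  fixes \<sigma> :: "(real^'d) measure"
  assumes \<sigma>: "spectral_measure \<sigma>"
  shows "levy_measure \<alpha> \<sigma> l = density (levy_measure \<alpha> \<sigma> 0) (\<lambda>x. ennreal (exp (- l * norm x)))"
proof (rule measure_eqI)
  fix A assume "A \<in> sets (levy_measure \<alpha> \<sigma> l)"
  then have A [measurable]: "A \<in> sets borel" by simp
  have "space \<sigma> = sphere 0 1"
    using \<sigma> sets_eq_imp_space_eq[of \<sigma> "restrict_space borel (sphere 0 1)"]
    by (simp add: spectral_measure_def space_restrict_space)
  then have n: "norm (r *\<^sub>R \<theta>) = r" if "0 < r" "\<theta> \<in> space \<sigma>" for r \<theta>
    using that by simp
  have "emeasure (density (levy_measure \<alpha> \<sigma> 0) (\<lambda>x. ennreal (exp (- l * norm x)))) A =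
    (\<integral>\<^sup>+x. ennreal (exp (- l * norm x)) * indicator A x \<partial>levy_measure \<alpha> \<sigma> 0)"
    by (rule emeasure_density) (simp_all add: measurable_cong_sets[OF sets_levy_measure refl])
  also have "\<dots> = levy_content \<alpha> \<sigma> l A"
    unfolding levy_content_def
    by (subst nn_integral_levy_measure[OF \<sigma>])
      (auto intro!: nn_integral_cong simp: n ennreal_mult indicator_def mult.commute simp del: norm_scaleR)
  finally show "emeasure (levy_measure \<alpha> \<sigma> l) A =
    emeasure (density (levy_measure \<alpha> \<sigma> 0) (\<lambda>x. ennreal (exp (- l * norm x)))) A"
    by (simp add: emeasure_levy_measure[OF \<sigma> A])
qed simp

text \<open>In polar coordinates this is a radial integral times the finite mass of \<sigma>. Near 0
  the radial integrand is r powr (1 - \<alpha>), integrable because \<alpha> < 2; near infinity it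
  is r powr (-\<alpha> - 1), integrable because \<alpha> > 0.\<close>

lemma integrable_levy_measure:
  fixes \<sigma> :: "(real^'d) measure"
  assumes \<sigma>: "spectral_measure \<sigma>" and \<alpha>: "0 < \<alpha>" "\<alpha> < 2"
  shows "integrable (levy_measure \<alpha> \<sigma> 0) (\<lambda>x. min 1 ((norm x)\<^sup>2))"
proof (rule integrableI_bounded)
  interpret \<sigma>: finite_measure \<sigma> using \<sigma> by (simp add: spectral_measure_def)
  have "space \<sigma> = sphere 0 1"
    using \<sigma> sets_eq_imp_space_eq[of \<sigma> "restrict_space borel (sphere 0 1)"]
    by (simp add: spectral_measure_def space_restrict_space)
  then have n: "norm (r *\<^sub>R \<theta>) = r" if "0 < r" "\<theta> \<in> space \<sigma>" for r \<theta>
    using that by simp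
  let ?I = "\<integral>\<^sup>+r\<in>{0<..}. ennreal (min 1 (r\<^sup>2)) * ennreal (r powr (-\<alpha> - 1)) \<partial>lborel"
  have "((\<lambda>r. r powr (1 - \<alpha>)) has_integral (1 powr (2 - \<alpha>) / (2 - \<alpha>))) {0..1}"
    using has_integral_powr_from_0[of "1 - \<alpha>" 1] \<alpha> by simp
  from nn_integral_has_integral_lebesgue[OF _ this]
  have 1: "(\<integral>\<^sup>+r. ennreal (indicator {0..1} r * r powr (1 - \<alpha>)) \<partial>lborel) < \<infinity>" by simp
  have "((\<lambda>r. r powr (-\<alpha> - 1)) has_integral - (1 powr (-\<alpha>)) / (-\<alpha>)) {1..}"
    using has_integral_powr_to_inf[of "-\<alpha> - 1" 1] \<alpha> by simp
  from nn_integral_has_integral_lebesgue[OF _ this]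
  have 2: "(\<integral>\<^sup>+r. ennreal (indicator {1..} r * r powr (-\<alpha> - 1)) \<partial>lborel) < \<infinity>" by simp
  have "?I \<le> (\<integral>\<^sup>+r. ennreal (indicator {0..1} r * r powr (1 - \<alpha>)) +
      ennreal (indicator {1..} r * r powr (-\<alpha> - 1)) \<partial>lborel)"
  proof (rule nn_integral_mono)
    fix r :: real
    show "ennreal (min 1 (r\<^sup>2)) * ennreal (r powr (-\<alpha> - 1)) * indicator {0<..} r \<le>
      ennreal (indicator {0..1} r * r powr (1 - \<alpha>)) + ennreal (indicator {1..} r * r powr (-\<alpha> - 1))"
    proof (cases "0 < r")
      case True
      have "r\<^sup>2 * r powr (-\<alpha> - 1) = r powr (1 - \<alpha>)"
        using True powr_add[of r 2 "-\<alpha> - 1"] by (simp add: powr_numeral)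
      moreover have "min 1 (r\<^sup>2) * r powr (-\<alpha> - 1) \<le> r\<^sup>2 * r powr (-\<alpha> - 1)"
        "min 1 (r\<^sup>2) * r powr (-\<alpha> - 1) \<le> 1 * r powr (-\<alpha> - 1)"
        by (intro mult_right_mono; simp)+
      ultimately have "min 1 (r\<^sup>2) * r powr (-\<alpha> - 1) \<le>
        indicator {0..1} r * r powr (1 - \<alpha>) + indicator {1..} r * r powr (-\<alpha> - 1)"
        using True by (auto simp: indicator_def)
      then show ?thesis using True
        by (simp add: ennreal_mult[symmetric] ennreal_plus[symmetric] ennreal_leI del: ennreal_plus)
    qed simp
  qed
  also have "\<dots> < \<infinity>"
    using 1 2 by (subst nn_integral_add) auto
  finally have I: "?I < \<infinity>" .
  have "(\<integral>\<^sup>+x. ennreal (norm (min 1 ((norm x)\<^sup>2))) \<partial>levy_measure \<alpha> \<sigma> 0) = (\<integral>\<^sup>+\<theta>. ?I \<partial>\<sigma>)"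
    by (subst nn_integral_levy_measure[OF \<sigma>], simp, intro nn_integral_cong)
      (auto simp: n indicator_def simp del: norm_scaleR)
  also have "\<dots> < \<infinity>"
    using I \<sigma>.emeasure_finite[of "space \<sigma>"] by (simp add: ennreal_mult_eq_top_iff less_top[symmetric])
  finally show "(\<integral>\<^sup>+x. ennreal (norm (min 1 ((norm x)\<^sup>2))) \<partial>levy_measure \<alpha> \<sigma> 0) < \<infinity>" .
qed (simp add: measurable_cong_sets[OF sets_levy_measure refl])

section \<open>Elementary inequalities for the cosine\<close>

lemma one_minus_cos_le:
  fixes z :: real
  shows "1 - cos z \<le> z\<^sup>2 / 2" "0 \<le> 1 - cos z" "1 - cos z \<le> 2"
proof -
  have "1 - cos z = 2 * (sin (z / 2))\<^sup>2"
    using cos_double_sin[of "z / 2"] by simp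
  also have "\<dots> \<le> 2 * (z / 2)\<^sup>2"
    using abs_sin_x_le_abs_x[of "z / 2"] unfolding abs_le_square_iff by simp
  finally show "1 - cos z \<le> z\<^sup>2 / 2" by (simp add: power2_eq_square)
  show "1 - cos z \<le> 2" using cos_ge_minus_one[of z] by linarith
qed simp

text \<open>The quadratic bound is used for small x and the bound 2 for large x; 2 + c^2 is a crude
  constant that covers both. Uniformity over |u| \<le> c makes the right side a majorant along
  bounded sequences of u.\<close>

lemma one_minus_cos_inner_le:
  fixes u x :: "'a::real_inner"
  assumes "norm u \<le> c"
  shows "1 - cos (u \<bullet> x) \<le> (2 + c\<^sup>2) * min 1 ((norm x)\<^sup>2)"
proof -
  have "(u \<bullet> x)\<^sup>2 \<le> (norm u * norm x)\<^sup>2"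
    using Cauchy_Schwarz_ineq2[of u x] by (simp add: abs_le_square_iff[symmetric] abs_mult)
  also have "\<dots> \<le> (c * norm x)\<^sup>2"
    using assms by (intro power_mono mult_right_mono) auto
  finally have "1 - cos (u \<bullet> x) \<le> c\<^sup>2 * (norm x)\<^sup>2"
    using one_minus_cos_le(1)[of "u \<bullet> x"] zero_le_power2[of "u \<bullet> x"] unfolding power_mult_distrib by linarith
  also have "\<dots> \<le> (2 + c\<^sup>2) * (norm x)\<^sup>2" by (intro mult_right_mono) auto
  finally show ?thesis
    using order_trans[OF one_minus_cos_le(3)[of "u \<bullet> x"], of "2 + c\<^sup>2"] by (simp add: min_def)
qed

text \<open>Integrated against the Levy measure, this says that $\sqrt{-\psi}$ is subadditive, in a form free
  of square roots.\<close>

lemma cos_diff_le: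
  fixes a b \<epsilon> :: real
  assumes \<epsilon>: "0 < \<epsilon>"
  shows "\<bar>cos a - cos b\<bar> \<le> \<epsilon> * (1 - cos b) + (1 + 1 / \<epsilon>) * (1 - cos (a - b))"
proof -
  \<comment> \<open>Half angles: 1 - cos z is twice the square of sin (z / 2), so the claim compares
    the squares of \<open>A\<close> and \<open>s\<close>. As |sin| is subadditive, \<open>A\<close>
    and \<open>s\<close> differ by at most \<open>t\<close>.\<close>
  define s t A where "s = \<bar>sin (b / 2)\<bar>" and "t = \<bar>sin ((a - b) / 2)\<bar>" and "A = \<bar>sin (a / 2)\<bar>"
  have sin_add: "\<bar>sin (x + y)\<bar> \<le> \<bar>sin x\<bar> + \<bar>sin y\<bar>" for x y :: real
  proof -
    have "\<bar>sin (x + y)\<bar> \<le> \<bar>sin x\<bar> * \<bar>cos y\<bar> + \<bar>cos x\<bar> * \<bar>sin y\<bar>"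
      unfolding sin_add by (metis abs_mult abs_triangle_ineq)
    also have "\<dots> \<le> \<bar>sin x\<bar> * 1 + 1 * \<bar>sin y\<bar>"
      by (intro add_mono mult_mono) auto
    finally show ?thesis by simp
  qed
  have 1: "A \<le> s + t"
    using sin_add[of "b / 2" "(a - b) / 2"] by (simp add: s_def t_def A_def field_simps)
  have 2: "s \<le> A + t"
    using sin_add[of "a / 2" "- ((a - b) / 2)"] by (simp add: s_def t_def A_def field_simps)
  have nn: "0 \<le> s" "0 \<le> t" "0 \<le> A" by (auto simp: s_def t_def A_def)
  \<comment> \<open>Weighted arithmetic-geometric mean inequality. The weight \<epsilon> makes the
    term in \<open>s\<close> as small as desired at the price of a factor 1/\<epsilon> on
    \<open>t\<close>.\<close>
  have am: "2 * s * t \<le> \<epsilon> * s\<^sup>2 + t\<^sup>2 / \<epsilon>"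
  proof -
    have "0 \<le> (\<epsilon> * s - t)\<^sup>2 / \<epsilon>" using \<epsilon> by simp
    also have "\<dots> = \<epsilon> * s\<^sup>2 + t\<^sup>2 / \<epsilon> - 2 * s * t"
      using \<epsilon> by (simp add: power2_eq_square field_simps)
    finally show ?thesis by simp
  qed
  have "A\<^sup>2 \<le> (s + t)\<^sup>2" using 1 nn by (intro power_mono) auto
  then have "A\<^sup>2 - s\<^sup>2 \<le> 2 * s * t + t\<^sup>2" by (simp add: power2_sum)
  moreover have "s\<^sup>2 \<le> (A + t)\<^sup>2" using 2 nn by (intro power_mono) auto
  \<comment> \<open>Squaring s - t \<le> A is legitimate only for s \<ge> t; in the other case the
    square of s is already at most that of t.\<close>
  moreover have "s\<^sup>2 - A\<^sup>2 \<le> 2 * s * t + t\<^sup>2"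
  proof (cases "s \<le> t")
    case True
    then have "s\<^sup>2 \<le> t\<^sup>2" using nn by (intro power_mono) auto
    then show ?thesis using nn by (smt (verit) mult_nonneg_nonneg zero_le_power2)
  next
    case False
    then have "(s - t)\<^sup>2 \<le> A\<^sup>2" using 2 nn by (intro power_mono) auto
    then show ?thesis using zero_le_power2[of t] unfolding power2_diff by linarith
  qed
  ultimately have m: "\<bar>A\<^sup>2 - s\<^sup>2\<bar> \<le> \<epsilon> * s\<^sup>2 + (1 + 1 / \<epsilon>) * t\<^sup>2"
    using am by (simp add: abs_le_iff algebra_simps)
  have h: "1 - cos z = 2 * \<bar>sin (z / 2)\<bar>\<^sup>2" for z :: real
    using cos_double_sin[of "z / 2"] by simp
  have "cos a - cos b = - (2 * (A\<^sup>2 - s\<^sup>2))"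
    using h[of a] h[of b] by (simp add: A_def s_def)
  then have e: "\<bar>cos a - cos b\<bar> = 2 * \<bar>A\<^sup>2 - s\<^sup>2\<bar>" by (simp only: abs_minus_cancel abs_mult abs_numeral)
  have st: "1 - cos b = 2 * s\<^sup>2" "1 - cos (a - b) = 2 * t\<^sup>2"
    by (simp_all only: h s_def t_def)
  show ?thesis unfolding e st using m by (simp add: algebra_simps)
qed

section \<open>Bounds, continuity and limits of the exponent\<close>

lemma borel_measurable_levy_measure: "f \<in> borel_measurable (levy_measure \<alpha> \<sigma> l) \<longleftrightarrow> f \<in> borel_measurable borel"
  by (simp add: measurable_cong_sets[OF sets_levy_measure refl])

lemma levy_psi_uminus: "levy_psi \<alpha> \<sigma> l (- u) = levy_psi \<alpha> \<sigma> l u"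
  by (simp add: levy_psi_def)

lemma levy_psi_zero: "levy_psi \<alpha> \<sigma> l 0 = 0"
  by (simp add: levy_psi_def)

context
  fixes \<sigma> :: "(real^'d) measure" and \<alpha> :: real
  assumes \<sigma>: "spectral_measure \<sigma>" and \<alpha>: "0 < \<alpha>" "\<alpha> < 2"
begin

lemma integrable_levy_exponent:
  assumes "0 \<le> l"
  shows "integrable (levy_measure \<alpha> \<sigma> 0) (\<lambda>x. exp (- l * norm x) * (1 - cos (u \<bullet> x)))"
proof (rule Bochner_Integration.integrable_bound)
  show "integrable (levy_measure \<alpha> \<sigma> 0) (\<lambda>x. (2 + (norm u)\<^sup>2) * min 1 ((norm x)\<^sup>2))"
    using integrable_levy_measure[OF \<sigma> \<alpha>] by (intro integrable_mult_right)
  have "exp (- l * norm x) * (1 - cos (u \<bullet> x)) \<le> 1 * ((2 + (norm u)\<^sup>2) * min 1 ((norm x)\<^sup>2))" for x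
    using assms one_minus_cos_inner_le[of u "norm u" x] one_minus_cos_le(2)[of "u \<bullet> x"] by (intro mult_mono) auto
  moreover have "0 \<le> exp (- l * norm x) * (1 - cos (u \<bullet> x))" for x
    using one_minus_cos_le(2)[of "u \<bullet> x"] by simp
  ultimately show "AE x in levy_measure \<alpha> \<sigma> 0. norm (exp (- l * norm x) * (1 - cos (u \<bullet> x))) \<le>
      norm ((2 + (norm u)\<^sup>2) * min 1 ((norm x)\<^sup>2))"
    by (intro AE_I2) (simp del: mult_minus_left abs_mult mult_1 add: abs_of_nonneg)
qed (simp add: borel_measurable_levy_measure)

text \<open>The parameter l moves from the measure into the integrand, and the sign is arranged so
  that the integrand is nonnegative. Comparisons between different l then become pointwise
  comparisons under one measure.\<close>

lemma levy_psi_eq: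
  "levy_psi \<alpha> \<sigma> l u = - (\<integral>x. exp (- l * norm x) * (1 - cos (u \<bullet> x)) \<partial>levy_measure \<alpha> \<sigma> 0)"
proof -
  have "levy_psi \<alpha> \<sigma> l u = (\<integral>x. exp (- l * norm x) * (cos (u \<bullet> x) - 1) \<partial>levy_measure \<alpha> \<sigma> 0)"
    unfolding levy_psi_def levy_measure_eq_density[OF \<sigma>, of \<alpha> l]
    by (subst integral_density) (auto simp: borel_measurable_levy_measure)
  also have "\<dots> = (\<integral>x. - (exp (- l * norm x) * (1 - cos (u \<bullet> x))) \<partial>levy_measure \<alpha> \<sigma> 0)"
    by (simp add: algebra_simps)
  finally show ?thesis by simp
qed

lemma levy_psi_nonpos: "levy_psi \<alpha> \<sigma> l u \<le> 0"
  unfolding levy_psi_eq using one_minus_cos_le(2) by (simp add: integral_nonneg_AE)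

lemma levy_psi_0_le:
  assumes "0 \<le> l"
  shows "levy_psi \<alpha> \<sigma> 0 u \<le> levy_psi \<alpha> \<sigma> l u"
  unfolding levy_psi_eq neg_le_iff_le
proof (rule integral_mono[OF integrable_levy_exponent integrable_levy_exponent])
  show "exp (- l * norm x) * (1 - cos (u \<bullet> x)) \<le> exp (- 0 * norm x) * (1 - cos (u \<bullet> x))" for x
    using assms by (intro mult_right_mono) auto
qed (use assms in auto)

text \<open>\<open>cos_diff_le\<close> integrated. It turns smallness of \<psi> (a - b) into
  closeness of \<psi> a and \<psi> b with relative error \<epsilon>. Later \<epsilon> = 1 gives
  integrability, and small \<epsilon> gives convergence.\<close>

lemma levy_psi_diff_le:
  assumes l: "0 \<le> l" and \<epsilon>: "0 < \<epsilon>"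
  shows "\<bar>levy_psi \<alpha> \<sigma> l a - levy_psi \<alpha> \<sigma> l b\<bar> \<le>
    - \<epsilon> * levy_psi \<alpha> \<sigma> l b - (1 + 1 / \<epsilon>) * levy_psi \<alpha> \<sigma> l (a - b)"
proof -
  let ?g = "\<lambda>u x. exp (- l * norm x) * (1 - cos (u \<bullet> x))"
  note i = integrable_levy_exponent[OF l]
  have "\<bar>levy_psi \<alpha> \<sigma> l a - levy_psi \<alpha> \<sigma> l b\<bar> = \<bar>\<integral>x. ?g b x - ?g a x \<partial>levy_measure \<alpha> \<sigma> 0\<bar>"
    unfolding levy_psi_eq by (subst Bochner_Integration.integral_diff[OF i i]) simp
  also have "\<dots> \<le> (\<integral>x. \<bar>?g b x - ?g a x\<bar> \<partial>levy_measure \<alpha> \<sigma> 0)"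
    by (rule integral_abs_bound)
  also have "\<dots> \<le> (\<integral>x. \<epsilon> * ?g b x + (1 + 1 / \<epsilon>) * ?g (a - b) x \<partial>levy_measure \<alpha> \<sigma> 0)"
  proof (rule integral_mono)
    show "\<bar>?g b x - ?g a x\<bar> \<le> \<epsilon> * ?g b x + (1 + 1 / \<epsilon>) * ?g (a - b) x" for x
    proof -
      have "\<bar>?g b x - ?g a x\<bar> = exp (- l * norm x) * \<bar>cos (a \<bullet> x) - cos (b \<bullet> x)\<bar>"
        by (simp add: right_diff_distrib[symmetric] abs_mult)
      also have "\<dots> \<le> exp (- l * norm x) *
          (\<epsilon> * (1 - cos (b \<bullet> x)) + (1 + 1 / \<epsilon>) * (1 - cos (a \<bullet> x - b \<bullet> x)))"
        by (intro mult_left_mono cos_diff_le \<epsilon>) simp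
      finally show ?thesis by (simp add: inner_diff_left algebra_simps)
    qed
  qed (intro integrable_abs Bochner_Integration.integrable_diff Bochner_Integration.integrable_add
      integrable_mult_right i)+
  also have "\<dots> = - \<epsilon> * levy_psi \<alpha> \<sigma> l b - (1 + 1 / \<epsilon>) * levy_psi \<alpha> \<sigma> l (a - b)"
    unfolding levy_psi_eq
    by (subst Bochner_Integration.integral_add) (intro integrable_mult_right i, intro integrable_mult_right i, simp)
  finally show ?thesis .
qed

lemma levy_psi_continuous:
  assumes l: "0 \<le> l"
  shows "continuous_on UNIV (levy_psi \<alpha> \<sigma> l)"
proof (rule continuous_on_sequentiallyI)
  fix v :: "nat \<Rightarrow> real^'d" and u assume v: "v \<longlonglongrightarrow> u"
  \<comment> \<open>A convergent sequence is bounded, so one constant \<open>c\<close> gives a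
    majorant valid for all n.\<close>
  then obtain c where c: "\<And>n. norm (v n) \<le> c"
    by (meson Bseq_def convergentI convergent_imp_Bseq)
  show "(\<lambda>n. levy_psi \<alpha> \<sigma> l (v n)) \<longlonglongrightarrow> levy_psi \<alpha> \<sigma> l u"
    unfolding levy_psi_eq
  proof (intro tendsto_minus integral_dominated_convergence[where w="\<lambda>x. (2 + c\<^sup>2) * min 1 ((norm x)\<^sup>2)"])
    show "AE x in levy_measure \<alpha> \<sigma> 0. norm (exp (- l * norm x) * (1 - cos (v n \<bullet> x))) \<le>
      (2 + c\<^sup>2) * min 1 ((norm x)\<^sup>2)" for n
    proof (rule AE_I2)
      fix x
      have "exp (- l * norm x) * (1 - cos (v n \<bullet> x)) \<le> 1 * ((2 + c\<^sup>2) * min 1 ((norm x)\<^sup>2))"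
        using l one_minus_cos_inner_le[OF c[of n], of x] one_minus_cos_le(2)[of "v n \<bullet> x"] by (intro mult_mono) auto
      then show "norm (exp (- l * norm x) * (1 - cos (v n \<bullet> x))) \<le> (2 + c\<^sup>2) * min 1 ((norm x)\<^sup>2)"
        using one_minus_cos_le(2)[of "v n \<bullet> x"] by (simp add: abs_mult)
    qed
    show "AE x in levy_measure \<alpha> \<sigma> 0.
      (\<lambda>n. exp (- l * norm x) * (1 - cos (v n \<bullet> x))) \<longlonglongrightarrow> exp (- l * norm x) * (1 - cos (u \<bullet> x))"
      by (intro AE_I2 tendsto_intros v)
    show "integrable (levy_measure \<alpha> \<sigma> 0) (\<lambda>x. (2 + c\<^sup>2) * min 1 ((norm x)\<^sup>2))"
      using integrable_levy_measure[OF \<sigma> \<alpha>] by (intro integrable_mult_right)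
  qed (auto simp: borel_measurable_levy_measure)
qed

lemma levy_psi_tendsto:
  assumes l: "\<And>n. 0 \<le> l n" "l \<longlonglongrightarrow> 0"
  shows "(\<lambda>n::nat. levy_psi \<alpha> \<sigma> (l n) u) \<longlonglongrightarrow> levy_psi \<alpha> \<sigma> 0 u"
  unfolding levy_psi_eq
proof (intro tendsto_minus integral_dominated_convergence[where w="\<lambda>x. exp (- 0 * norm x) * (1 - cos (u \<bullet> x))"])
  show "AE x in levy_measure \<alpha> \<sigma> 0. norm (exp (- l n * norm x) * (1 - cos (u \<bullet> x))) \<le>
      exp (- 0 * norm x) * (1 - cos (u \<bullet> x))" for n
  proof (rule AE_I2)
    fix x
    have "exp (- l n * norm x) * (1 - cos (u \<bullet> x)) \<le> 1 * (1 - cos (u \<bullet> x))"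
      using l(1)[of n] by (intro mult_right_mono) auto
    then show "norm (exp (- l n * norm x) * (1 - cos (u \<bullet> x))) \<le> exp (- 0 * norm x) * (1 - cos (u \<bullet> x))"
      using one_minus_cos_le(2)[of "u \<bullet> x"] by (simp add: abs_mult)
  qed
  show "AE x in levy_measure \<alpha> \<sigma> 0.
      (\<lambda>n. exp (- l n * norm x) * (1 - cos (u \<bullet> x))) \<longlonglongrightarrow> exp (- 0 * norm x) * (1 - cos (u \<bullet> x))"
    by (intro AE_I2 tendsto_intros l)
  show "integrable (levy_measure \<alpha> \<sigma> 0) (\<lambda>x. exp (- 0 * norm x) * (1 - cos (u \<bullet> x)))"
    by (rule integrable_levy_exponent) simp
qed (auto simp: borel_measurable_levy_measure)

end

section \<open>Integrals of simple functions\<close>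

text \<open>Independence and additivity of a random measure are postulated for sequences of sets. A
  finite family is brought into that form by listing it and padding with the empty set.\<close>

lemma fin_borel_enumerate:
  fixes B :: "'b \<Rightarrow> (real^'n) set"
  assumes V: "finite V" and B: "\<And>v. v \<in> V \<Longrightarrow> B v \<in> fin_borel" "disjoint_family_on B V"
  obtains h :: "nat \<Rightarrow> 'b" and A where "bij_betw h {0..<card V} V" "\<And>i. i < card V \<Longrightarrow> A i = B (h i)"
    "\<And>i. \<not> i < card V \<Longrightarrow> A i = {}" "\<And>i. A i \<in> fin_borel" "disjoint_family A"
proof -
  from ex_bij_betw_nat_finite[OF V] obtain h where h: "bij_betw h {0..<card V} V" by blast
  define A where "A i = (if i < card V then B (h i) else {})" for i
  have hV: "h i \<in> V" if "i < card V" for i using h that by (auto simp: bij_betw_def)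
  show ?thesis
  proof (rule that[OF h])
    show "A i \<in> fin_borel" for i using B(1) hV by (simp add: A_def fin_borel_def)
    show "disjoint_family A"
      unfolding disjoint_family_on_def
    proof (intro ballI impI)
      fix i j :: nat assume ij: "i \<noteq> j"
      show "A i \<inter> A j = {}"
      proof (cases "i < card V \<and> j < card V")
        case True
        then have "h i \<noteq> h j" using h ij by (auto simp: bij_betw_def inj_on_def)
        then show ?thesis using True B(2) hV by (auto simp: A_def disjoint_family_on_def)
      qed (auto simp: A_def)
    qed
  qed (auto simp: A_def)
qed

text \<open>The support of \<open>F\<close> has finite measure, so the level set of 0 has infinite
  measure and a random measure assigns it no meaningful value. This is the reason for the condition
  \<open>D \<noteq> 0\<close>.\<close>

lemma simple_bochner_integrable_vimage:
  fixes F :: "real^'n \<Rightarrow> 'b::real_vector"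
  assumes F: "Bochner_Integration.simple_bochner_integrable lborel F"
  shows "F -` {D} \<in> sets borel" "D \<noteq> 0 \<Longrightarrow> F -` {D} \<in> fin_borel" "finite (range F)"
proof -
  from F have sf: "simple_function lborel F" and fin: "emeasure lborel {y. F y \<noteq> 0} \<noteq> \<infinity>"
    by (auto simp: simple_bochner_integrable.simps)
  show r: "finite (range F)" using sf by (simp add: simple_function_def)
  show m: "F -` {D} \<in> sets borel" for D
  proof (cases "D \<in> range F")
    case True
    then show ?thesis using sf by (auto simp: simple_function_def)
  next
    case False
    then have "F -` {D} = {}" by auto
    then show ?thesis by simp
  qed
  have "{y. F y \<noteq> 0} = (\<Union>D\<in>range F - {0}. F -` {D})" by auto
  then have mm: "{y. F y \<noteq> 0} \<in> sets borel" using r m by auto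
  show "F -` {D} \<in> fin_borel" if "D \<noteq> 0"
  proof -
    have "emeasure lborel (F -` {D}) \<le> emeasure lborel {y. F y \<noteq> 0}"
      using that mm by (intro emeasure_mono) auto
    then show ?thesis using m fin by (auto simp: fin_borel_def less_top[symmetric] top_unique)
  qed
qed

section \<open>Random measures on finitely many disjoint sets\<close>

context
  fixes P :: "'w measure" and \<psi> :: "real^'d \<Rightarrow> real" and M :: "(real^'n) set \<Rightarrow> 'w \<Rightarrow> real^'d"
  assumes rm: "random_measure P \<psi> M"
begin

lemma random_measure_prob_space: "prob_space P"
  using rm by (simp add: random_measure_def)

lemma random_measure_measurable [measurable]: "A \<in> fin_borel \<Longrightarrow> M A \<in> borel_measurable P"
  using rm by (simp add: random_measure_def)

lemma random_measure_indep:
  fixes A :: "nat \<Rightarrow> (real^'n) set"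
  assumes "\<And>i. A i \<in> fin_borel" "disjoint_family A"
  shows "prob_space.indep_vars P (\<lambda>_. borel) (\<lambda>i. M (A i)) UNIV"
proof -
  have "range A \<subseteq> fin_borel" using assms(1) by auto
  with rm assms(2) show ?thesis unfolding random_measure_def by blast
qed

lemma random_measure_sums:
  fixes A :: "nat \<Rightarrow> (real^'n) set"
  assumes "\<And>i. A i \<in> fin_borel" "disjoint_family A" "(\<Union>i. A i) \<in> fin_borel"
  shows "AE \<omega> in P. (\<lambda>i. M (A i) \<omega>) sums M (\<Union>i. A i) \<omega>"
proof -
  have "range A \<subseteq> fin_borel" using assms(1) by auto
  with rm assms(2,3) show ?thesis unfolding random_measure_def by blast
qed

lemma random_measure_char:
  assumes "A \<in> fin_borel"
  shows "(CLINT \<omega>|P. iexp (u \<bullet> M A \<omega>)) = exp (complex_of_real (measure lborel A * \<psi> u))"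
  using rm assms unfolding random_measure_def by blast

text \<open>Additivity along the constant sequence of empty sets makes a constant series converge,
  which forces its terms to vanish.\<close>

lemma random_measure_empty: "AE \<omega> in P. M {} \<omega> = 0"
proof -
  have "AE \<omega> in P. (\<lambda>i::nat. M {} \<omega>) sums M (\<Union>i::nat. {}) \<omega>"
    by (rule random_measure_sums) (auto simp: fin_borel_def disjoint_family_on_def)
  then show ?thesis
    by eventually_elim (auto dest!: sums_summable simp: summable_const_iff)
qed

text \<open>Countable additivity for the padded sequence; the padding contributes 0 almost surely,
  so the series is a finite sum.\<close>

lemma random_measure_finite_Union:
  fixes B :: "'b \<Rightarrow> (real^'n) set"
  assumes V: "finite V" and B: "\<And>v. v \<in> V \<Longrightarrow> B v \<in> fin_borel" "disjoint_family_on B V"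
    and U: "(\<Union>v\<in>V. B v) \<in> fin_borel"
  shows "AE \<omega> in P. M (\<Union>v\<in>V. B v) \<omega> = (\<Sum>v\<in>V. M (B v) \<omega>)"
proof -
  from fin_borel_enumerate[OF V B] obtain h A where h: "bij_betw h {0..<card V} V"
    and AB: "\<And>i. i < card V \<Longrightarrow> A i = B (h i)" "\<And>i. \<not> i < card V \<Longrightarrow> A i = {}"
    and A: "\<And>i. A i \<in> fin_borel" and dis: "disjoint_family A" by blast
  have "x \<in> A i \<longleftrightarrow> i \<in> {0..<card V} \<and> x \<in> B (h i)" for x i
    using AB[of i] by (cases "i < card V") auto
  then have "(\<Union>i. A i) = (\<Union>v\<in>h ` {0..<card V}. B v)" by blast
  also have "h ` {0..<card V} = V" using h by (simp add: bij_betw_def)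
  finally have UA: "(\<Union>i. A i) = (\<Union>v\<in>V. B v)" .
  have "AE \<omega> in P. (\<lambda>i. M (A i) \<omega>) sums M (\<Union>v\<in>V. B v) \<omega>"
    using random_measure_sums[OF A dis] U unfolding UA by blast
  with random_measure_empty show ?thesis
  proof eventually_elim
    case (elim \<omega>)
    have "(\<lambda>i. M (A i) \<omega>) sums (\<Sum>i\<in>{0..<card V}. M (A i) \<omega>)"
      by (rule sums_finite) (use elim AB(2) in auto)
    with elim have "M (\<Union>v\<in>V. B v) \<omega> = (\<Sum>i\<in>{0..<card V}. M (A i) \<omega>)" using sums_unique2 by blast
    also have "\<dots> = (\<Sum>i\<in>{0..<card V}. M (B (h i)) \<omega>)" by (intro sum.cong) (auto simp: AB)
    also have "\<dots> = (\<Sum>v\<in>V. M (B v) \<omega>)" by (rule sum.reindex_bij_betw[OF h])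
    finally show ?case .
  qed
qed

text \<open>Independence turns the expectation of the product into a product of expectations. The
  padding is discarded by restricting the independent sequence to its first \<open>card V\<close>
  members.\<close>

lemma random_measure_char_sum:
  fixes B :: "'b \<Rightarrow> (real^'n) set"
  assumes V: "finite V" and B: "\<And>v. v \<in> V \<Longrightarrow> B v \<in> fin_borel" "disjoint_family_on B V"
  shows "(CLINT \<omega>|P. iexp (\<Sum>v\<in>V. w v \<bullet> M (B v) \<omega>)) =
    exp (complex_of_real (\<Sum>v\<in>V. measure lborel (B v) * \<psi> (w v)))"
proof -
  interpret prob_space P by (rule random_measure_prob_space)
  from fin_borel_enumerate[OF V B] obtain h A where h: "bij_betw h {0..<card V} V"
    and AB: "\<And>i. i < card V \<Longrightarrow> A i = B (h i)" "\<And>i. \<not> i < card V \<Longrightarrow> A i = {}"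
    and A: "\<And>i. A i \<in> fin_borel" and dis: "disjoint_family A" by blast
  have "indep_vars (\<lambda>_. borel) (\<lambda>i \<omega>. iexp (w (h i) \<bullet> M (A i) \<omega>)) UNIV"
    by (rule indep_vars_compose2[OF random_measure_indep[OF A dis], of "\<lambda>i x. iexp (w (h i) \<bullet> x)"]) simp
  then have ind: "indep_vars (\<lambda>_. borel) (\<lambda>i \<omega>. iexp (w (h i) \<bullet> M (A i) \<omega>)) {0..<card V}"
    by (rule indep_vars_subset) simp
  have "(CLINT \<omega>|P. iexp (\<Sum>v\<in>V. w v \<bullet> M (B v) \<omega>)) =
     (CLINT \<omega>|P. (\<Prod>i\<in>{0..<card V}. iexp (w (h i) \<bullet> M (A i) \<omega>)))"
  proof (rule Bochner_Integration.integral_cong)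
    fix \<omega>
    have "(\<Sum>v\<in>V. w v \<bullet> M (B v) \<omega>) = (\<Sum>i\<in>{0..<card V}. w (h i) \<bullet> M (B (h i)) \<omega>)"
      by (rule sum.reindex_bij_betw[OF h, symmetric])
    also have "\<dots> = (\<Sum>i\<in>{0..<card V}. w (h i) \<bullet> M (A i) \<omega>)"
      by (intro sum.cong) (auto simp: AB)
    finally show "iexp (\<Sum>v\<in>V. w v \<bullet> M (B v) \<omega>) = (\<Prod>i\<in>{0..<card V}. iexp (w (h i) \<bullet> M (A i) \<omega>))"
      by (simp add: exp_sum[symmetric] sum_distrib_left)
  qed simp
  also have "\<dots> = (\<Prod>i\<in>{0..<card V}. CLINT \<omega>|P. iexp (w (h i) \<bullet> M (A i) \<omega>))"
  proof (rule indep_vars_lebesgue_integral[OF _ ind])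
    fix i
    have [measurable]: "M (A i) \<in> borel_measurable P" using A by (rule random_measure_measurable)
    show "integrable P (\<lambda>\<omega>. iexp (w (h i) \<bullet> M (A i) \<omega>))"
      by (rule integrable_const_bound[where B=1]) auto
  qed simp
  also have "\<dots> = (\<Prod>i\<in>{0..<card V}. exp (complex_of_real (measure lborel (B (h i)) * \<psi> (w (h i)))))"
    by (intro prod.cong) (simp_all add: random_measure_char[OF A] AB(1)[symmetric])
  also have "\<dots> = (\<Prod>v\<in>V. exp (complex_of_real (measure lborel (B v) * \<psi> (w v))))"
    by (rule prod.reindex_bij_betw[OF h])
  also have "\<dots> = exp (complex_of_real (\<Sum>v\<in>V. measure lborel (B v) * \<psi> (w v)))"
    using V by (simp add: exp_sum)
  finally show ?thesis .
qed

lemma simple_stoch_integral_measurable: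
  assumes F: "Bochner_Integration.simple_bochner_integrable lborel F"
  shows "simple_stoch_integral M F \<in> borel_measurable P"
proof -
  have "(\<lambda>\<omega>. \<Sum>D\<in>range F - {0}. D *v M (F -` {D}) \<omega>) \<in> borel_measurable P"
  proof (rule borel_measurable_sum)
    fix D assume D: "D \<in> range F - {0}"
    then have "M (F -` {D}) \<in> borel_measurable P"
      using simple_bochner_integrable_vimage(2)[OF F] by auto
    moreover have "(\<lambda>x. D *v x) \<in> borel_measurable borel"
      by (intro borel_measurable_continuous_onI matrix_vector_mult_linear_continuous_on)
    ultimately show "(\<lambda>\<omega>. D *v M (F -` {D}) \<omega>) \<in> borel_measurable P"
      by (rule measurable_compose)
  qed
  then show ?thesis by (simp add: simple_stoch_integral_def[abs_def])
qed

text \<open>\<open>simple_stoch_integral\<close> sums over the level sets of its own integrand, and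
  these differ from one integrand to another. Here an integrand that factors through
  \<open>G\<close> is rewritten over the level sets of \<open>G\<close>, so that several integrands
  can share one partition. The value \<open>z\<close> is the one whose level set may have infinite
  measure; \<open>c z = 0\<close> lets it be left out.\<close>

lemma simple_stoch_integral_refine:
  fixes G :: "real^'n \<Rightarrow> 'b"
  assumes F: "Bochner_Integration.simple_bochner_integrable lborel F" and eq: "\<And>s. F s = c (G s)"
    and V: "finite V" "range G - {z} \<subseteq> V" "V \<subseteq> range G" "\<And>v. v \<in> V \<Longrightarrow> G -` {v} \<in> fin_borel" "c z = 0"
  shows "AE \<omega> in P. simple_stoch_integral M F \<omega> = (\<Sum>v\<in>V. c v *v M (G -` {v}) \<omega>)"
proof -
  let ?V = "\<lambda>D. {v\<in>V. c v = D}"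
  note R = simple_bochner_integrable_vimage[OF F]
  have vim: "F -` {D} = (\<Union>v\<in>?V D. G -` {v})" if "D \<noteq> 0" for D
  proof -
    have "G s \<in> V" if "c (G s) \<noteq> 0" for s using that V(2,5) by (cases "G s = z") auto
    then show ?thesis using \<open>D \<noteq> 0\<close> by (auto simp: eq)
  qed
  have "AE \<omega> in P. M (F -` {D}) \<omega> = (\<Sum>v\<in>?V D. M (G -` {v}) \<omega>)" if "D \<in> range F - {0}" for D
  proof -
    have "D \<noteq> 0" using that by auto
    show ?thesis
      unfolding vim[OF \<open>D \<noteq> 0\<close>]
    proof (rule random_measure_finite_Union)
      show "(\<Union>v\<in>?V D. G -` {v}) \<in> fin_borel"
        using R(2)[OF \<open>D \<noteq> 0\<close>] vim[OF \<open>D \<noteq> 0\<close>] by simp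
    qed (use V in \<open>auto simp: disjoint_family_on_def\<close>)
  qed
  then have "AE \<omega> in P. \<forall>D\<in>range F - {0}. M (F -` {D}) \<omega> = (\<Sum>v\<in>?V D. M (G -` {v}) \<omega>)"
    using R(3) by (intro AE_finite_allI) auto
  then show ?thesis
  proof eventually_elim
    case (elim \<omega>)
    have "simple_stoch_integral M F \<omega> = (\<Sum>D\<in>range F - {0}. \<Sum>v\<in>?V D. c v *v M (G -` {v}) \<omega>)"
      unfolding simple_stoch_integral_def
      using elim by (intro sum.cong) (simp_all add: linear_sum[OF matrix_vector_mul_linear])
    also have "\<dots> = (\<Sum>D\<in>range F - {0}. \<Sum>v\<in>{v\<in>{v\<in>V. c v \<noteq> 0}. c v = D}. c v *v M (G -` {v}) \<omega>)"
      by (intro sum.cong) auto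
    also have "\<dots> = (\<Sum>v\<in>{v\<in>V. c v \<noteq> 0}. c v *v M (G -` {v}) \<omega>)"
    proof (rule sum.group)
      show "c ` {v\<in>V. c v \<noteq> 0} \<subseteq> range F - {0}" using V(3) by (auto simp: eq[abs_def])
    qed (use V R in auto)
    also have "\<dots> = (\<Sum>v\<in>V. c v *v M (G -` {v}) \<omega>)"
      using V(1) by (intro sum.mono_neutral_left) auto
    finally show ?case .
  qed
qed

text \<open>On a level set of the vector of all integrands each of them is constant. Moving the
  matrices to the other side of the inner product, where they act as transposes in
  \<open>u j v* F j s\<close>, makes the linear combination a sum of independent terms. Because
  \<psi> 0 = 0, the part of space where all integrands vanish contributes nothing.\<close>

lemma simple_stoch_integral_char:
  fixes F :: "'j \<Rightarrow> real^'n \<Rightarrow> real^'d^'d" and u :: "'j \<Rightarrow> real^'d"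
  assumes J: "finite J" and F: "\<And>j. j \<in> J \<Longrightarrow> Bochner_Integration.simple_bochner_integrable lborel (F j)"
    and \<psi>0: "\<psi> 0 = 0"
  shows "integrable lborel (\<lambda>s. \<psi> (\<Sum>j\<in>J. u j v* F j s))"
    and "(CLINT \<omega>|P. iexp (\<Sum>j\<in>J. u j \<bullet> simple_stoch_integral M (F j) \<omega>)) =
      exp (complex_of_real (\<integral>s. \<psi> (\<Sum>j\<in>J. u j v* F j s) \<partial>lborel))"
proof -
  interpret prob_space P by (rule random_measure_prob_space)
  \<comment> \<open>The common refinement of the integrands. Setting the components outside
    \<open>J\<close> to 0 keeps the range finite although the index type may be infinite.\<close>
  define G where "G s = (\<lambda>j. if j \<in> J then F j s else 0)" for s
  define z :: "'j \<Rightarrow> real^'d^'d" where "z = (\<lambda>_. 0)"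
  define V where "V = range G - {z}"
  define w where "w v = (\<Sum>j\<in>J. u j v* v j)" for v :: "'j \<Rightarrow> real^'d^'d"
  note R = simple_bochner_integrable_vimage[OF F]
  have finG: "finite (range G)"
  proof (rule finite_subset)
    show "range G \<subseteq> {g. (\<forall>j\<in>J. g j \<in> range (F j)) \<and> (\<forall>j. j \<notin> J \<longrightarrow> g j = 0)}"
      by (auto simp: G_def)
    have "finite (PiE J (\<lambda>j. range (F j)))" using J R(3) by (intro finite_PiE) auto
    moreover have "{g. (\<forall>j\<in>J. g j \<in> range (F j)) \<and> (\<forall>j. j \<notin> J \<longrightarrow> g j = 0)} \<subseteq>
      (\<lambda>g j. if j \<in> J then g j else 0) ` (PiE J (\<lambda>j. range (F j)))"
    proof
      fix g assume g: "g \<in> {g. (\<forall>j\<in>J. g j \<in> range (F j)) \<and> (\<forall>j. j \<notin> J \<longrightarrow> g j = 0)}"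
      then have "g = (\<lambda>j. if j \<in> J then restrict g J j else 0)" by auto
      moreover have "restrict g J \<in> PiE J (\<lambda>j. range (F j))" using g by auto
      ultimately show "g \<in> (\<lambda>g j. if j \<in> J then g j else 0) ` (PiE J (\<lambda>j. range (F j)))" by blast
    qed
    ultimately show "finite {g. (\<forall>j\<in>J. g j \<in> range (F j)) \<and> (\<forall>j. j \<notin> J \<longrightarrow> g j = 0)}"
      using finite_subset by blast
  qed
  then have V: "finite V" by (simp add: V_def)
  have Gv: "G -` {v} \<in> fin_borel" if v: "v \<in> V" for v
  proof -
    from v obtain s where s: "v = G s" "v \<noteq> z" by (auto simp: V_def)
    then obtain j where j: "v j \<noteq> 0" by (auto simp: z_def)
    then have jJ: "j \<in> J" using s by (auto simp: G_def split: if_splits)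
    have "G -` {v} = (\<Inter>j\<in>J. F j -` {v j})"
    proof -
      have "G t = G s \<longleftrightarrow> (\<forall>j\<in>J. F j t = F j s)" for t
        unfolding G_def fun_eq_iff by auto
      moreover have "v j = F j s" if "j \<in> J" for j using s that by (simp add: G_def)
      ultimately show ?thesis using s(1) by auto
    qed
    then have m: "G -` {v} \<in> sets borel"
      using J jJ R(1) by (auto intro!: sets.finite_INT)
    have "emeasure lborel (G -` {v}) \<le> emeasure lborel (F j -` {v j})"
      using R(1)[OF jJ] jJ by (intro emeasure_mono) (auto simp: G_def)
    also have "\<dots> < \<infinity>" using R(2)[OF jJ j] by (simp add: fin_borel_def)
    finally show ?thesis using m by (simp add: fin_borel_def)
  qed
  have wz: "w z = 0" by (simp add: w_def z_def)
  have wG: "(\<Sum>j\<in>J. u j v* F j s) = w (G s)" for s by (simp add: w_def G_def)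
  have \<psi>G: "\<psi> (w (G s)) = (\<Sum>v\<in>V. indicator (G -` {v}) s * \<psi> (w v))" for s
  proof -
    have "(\<Sum>v\<in>V. indicator (G -` {v}) s * \<psi> (w v)) = (\<Sum>v\<in>V. if v = G s then \<psi> (w v) else 0)"
      by (intro sum.cong) auto
    also have "\<dots> = (if G s \<in> V then \<psi> (w (G s)) else 0)" using V by simp
    also have "\<dots> = \<psi> (w (G s))" using wz \<psi>0 by (auto simp: V_def)
    finally show ?thesis by simp
  qed
  have int: "integrable lborel (\<lambda>s. indicator (G -` {v}) s * \<psi> (w v))" if "v \<in> V" for v
    using Gv[OF that] by (intro integrable_mult_left) (auto simp: integrable_indicator_iff fin_borel_def)
  show "integrable lborel (\<lambda>s. \<psi> (\<Sum>j\<in>J. u j v* F j s))"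
    unfolding wG \<psi>G by (rule Bochner_Integration.integrable_sum[OF int])
  have I: "(\<integral>s. \<psi> (\<Sum>j\<in>J. u j v* F j s) \<partial>lborel) = (\<Sum>v\<in>V. measure lborel (G -` {v}) * \<psi> (w v))"
    unfolding wG \<psi>G
    by (subst Bochner_Integration.integral_sum[OF int]) auto
  have "AE \<omega> in P. \<forall>j\<in>J. simple_stoch_integral M (F j) \<omega> = (\<Sum>v\<in>V. v j *v M (G -` {v}) \<omega>)"
    using J by (intro AE_finite_allI simple_stoch_integral_refine[OF F, where c="\<lambda>v. v _" and z=z])
      (use V Gv in \<open>auto simp: V_def z_def G_def\<close>)
  then have "AE \<omega> in P. (\<Sum>j\<in>J. u j \<bullet> simple_stoch_integral M (F j) \<omega>) = (\<Sum>v\<in>V. w v \<bullet> M (G -` {v}) \<omega>)"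
  proof eventually_elim
    case (elim \<omega>)
    then have "(\<Sum>j\<in>J. u j \<bullet> simple_stoch_integral M (F j) \<omega>) =
        (\<Sum>j\<in>J. \<Sum>v\<in>V. (u j v* v j) \<bullet> M (G -` {v}) \<omega>)"
      by (intro sum.cong) (auto simp: inner_sum_right dot_lmul_matrix)
    also have "\<dots> = (\<Sum>v\<in>V. w v \<bullet> M (G -` {v}) \<omega>)"
      by (subst sum.swap) (simp add: w_def inner_sum_left)
    finally show ?case .
  qed
  then have "(CLINT \<omega>|P. iexp (\<Sum>j\<in>J. u j \<bullet> simple_stoch_integral M (F j) \<omega>)) =
      (CLINT \<omega>|P. iexp (\<Sum>v\<in>V. w v \<bullet> M (G -` {v}) \<omega>))"
  proof (intro integral_cong_AE)
    have [measurable]: "simple_stoch_integral M (F j) \<in> borel_measurable P" if "j \<in> J" for j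
      by (rule simple_stoch_integral_measurable[OF F[OF that]])
    show "(\<lambda>\<omega>. iexp (\<Sum>j\<in>J. u j \<bullet> simple_stoch_integral M (F j) \<omega>)) \<in> borel_measurable P"
      by measurable
    have [measurable]: "M (G -` {v}) \<in> borel_measurable P" if "v \<in> V" for v
      by (rule random_measure_measurable[OF Gv[OF that]])
    show "(\<lambda>\<omega>. iexp (\<Sum>v\<in>V. w v \<bullet> M (G -` {v}) \<omega>)) \<in> borel_measurable P"
      by measurable
  qed (erule eventually_mono, simp only:)
  also have "\<dots> = exp (complex_of_real (\<Sum>v\<in>V. measure lborel (G -` {v}) * \<psi> (w v)))"
    by (rule random_measure_char_sum[OF V Gv]) (auto simp: disjoint_family_on_def)
  finally show "(CLINT \<omega>|P. iexp (\<Sum>j\<in>J. u j \<bullet> simple_stoch_integral M (F j) \<omega>)) =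
      exp (complex_of_real (\<integral>s. \<psi> (\<Sum>j\<in>J. u j v* F j s) \<partial>lborel))"
    unfolding I .
qed

end

section \<open>Characteristic functions of stochastic integrals\<close>

lemma norm_iexp_diff_le:
  "cmod (iexp a - iexp b) \<le> \<bar>a - b\<bar>" "cmod (iexp a - iexp b) \<le> 2"
proof -
  have "iexp a - iexp b = iexp b * (iexp (a - b) - 1)"
    by (simp add: exp_diff field_simps)
  then have "cmod (iexp a - iexp b) = cmod (iexp (a - b) - 1)" by (simp add: norm_mult)
  also have "\<dots> \<le> \<bar>a - b\<bar>" using iexp_approx1[of "a - b" 0] by simp
  finally show "cmod (iexp a - iexp b) \<le> \<bar>a - b\<bar>" .
  show "cmod (iexp a - iexp b) \<le> 2"
    using norm_triangle_ineq4[of "iexp a" "iexp b"] by simp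
qed

text \<open>The complex exponential is both Lipschitz and bounded: the former controls the event
  where X and Y are close, the latter the complementary event of small probability.\<close>

lemma conv_in_prob_imp_iexp_L1:
  fixes X :: "nat \<Rightarrow> 'w \<Rightarrow> 'a::euclidean_space"
  assumes "prob_space P" and X: "conv_in_prob P X Y"
    and m [measurable]: "\<And>n. X n \<in> borel_measurable P" "Y \<in> borel_measurable P"
  shows "(\<lambda>n. \<integral>\<omega>. cmod (iexp (u \<bullet> X n \<omega>) - iexp (u \<bullet> Y \<omega>)) \<partial>P) \<longlonglongrightarrow> 0"
proof (rule LIMSEQ_I)
  interpret prob_space P by fact
  fix e :: real assume e: "0 < e"
  \<comment> \<open>The summand 1 avoids division by 0 for u = 0; the choice makes the Lipschitz
    part at most e / 2.\<close>
  define d where "d = e / (2 * (1 + norm u))"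
  have n1: "0 < 1 + norm u" by (smt (verit) norm_ge_zero)
  have d: "0 < d" using e n1 by (simp add: d_def)
  have ud: "norm u * d \<le> e / 2"
  proof -
    have "norm u * d \<le> (1 + norm u) * d" using d by simp
    also have "\<dots> = e / 2" using n1 by (simp only: d_def) (simp add: field_simps)
    finally show ?thesis .
  qed
  let ?A = "\<lambda>n. {\<omega>\<in>space P. d < norm (X n \<omega> - Y \<omega>)}"
  have int: "integrable P (\<lambda>\<omega>. cmod (iexp (u \<bullet> X n \<omega>) - iexp (u \<bullet> Y \<omega>)))" for n
    by (rule integrable_const_bound[where B=2]) (auto intro: norm_iexp_diff_le(2))
  have bnd: "(\<integral>\<omega>. cmod (iexp (u \<bullet> X n \<omega>) - iexp (u \<bullet> Y \<omega>)) \<partial>P) \<le> e / 2 + 2 * measure P (?A n)" for n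
  proof -
    have "(\<integral>\<omega>. cmod (iexp (u \<bullet> X n \<omega>) - iexp (u \<bullet> Y \<omega>)) \<partial>P) \<le> (\<integral>\<omega>. e / 2 + 2 * indicator (?A n) \<omega> \<partial>P)"
    proof (rule integral_mono[OF int])
      show "integrable P (\<lambda>\<omega>. e / 2 + 2 * indicator (?A n) \<omega>)"
        by (auto simp: integrable_indicator_iff emeasure_eq_measure)
      fix \<omega> assume \<omega>: "\<omega> \<in> space P"
      have "\<bar>u \<bullet> X n \<omega> - u \<bullet> Y \<omega>\<bar> \<le> norm u * norm (X n \<omega> - Y \<omega>)"
        unfolding inner_diff_right[symmetric] by (rule Cauchy_Schwarz_ineq2)
      then have "cmod (iexp (u \<bullet> X n \<omega>) - iexp (u \<bullet> Y \<omega>)) \<le> norm u * norm (X n \<omega> - Y \<omega>)"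
        using norm_iexp_diff_le(1)[of "u \<bullet> X n \<omega>" "u \<bullet> Y \<omega>"] by linarith
      moreover have "norm u * norm (X n \<omega> - Y \<omega>) \<le> norm u * d" if "norm (X n \<omega> - Y \<omega>) \<le> d"
        using that by (rule mult_left_mono) simp
      ultimately show "cmod (iexp (u \<bullet> X n \<omega>) - iexp (u \<bullet> Y \<omega>)) \<le> e / 2 + 2 * indicator (?A n) \<omega>"
        using ud norm_iexp_diff_le(2)[of "u \<bullet> X n \<omega>" "u \<bullet> Y \<omega>"] \<omega> e
        by (cases "norm (X n \<omega> - Y \<omega>) \<le> d") (auto simp: indicator_def)
    qed
    also have "\<dots> = e / 2 + 2 * measure P (?A n)"
      by (subst Bochner_Integration.integral_add) (auto simp: prob_space integrable_indicator_iff emeasure_eq_measure)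
    finally show ?thesis .
  qed
  have "(\<lambda>n. measure P (?A n)) \<longlonglongrightarrow> 0" using X d by (simp add: conv_in_prob_def)
  from LIMSEQ_D[OF this, of "e / 4"] e obtain N where N: "\<And>n. N \<le> n \<Longrightarrow> measure P (?A n) < e / 4" by auto
  show "\<exists>no. \<forall>n\<ge>no. norm ((\<integral>\<omega>. cmod (iexp (u \<bullet> X n \<omega>) - iexp (u \<bullet> Y \<omega>)) \<partial>P) - 0) < e"
  proof (intro exI allI impI)
    fix n assume "N \<le> n"
    from N[OF this] bnd[of n] show "norm ((\<integral>\<omega>. cmod (iexp (u \<bullet> X n \<omega>) - iexp (u \<bullet> Y \<omega>)) \<partial>P) - 0) < e"
      by (simp add: integral_nonneg_AE)
  qed
qed

lemma continuous_on_vector_matrix_mult: "continuous_on S (\<lambda>A::real^'m^'n. u v* A)"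
  unfolding vector_matrix_mult_def by (intro continuous_intros)

lemma vector_matrix_sum_measurable:
  fixes f :: "'j \<Rightarrow> 'a \<Rightarrow> real^'m^'n"
  assumes "\<And>j. j \<in> J \<Longrightarrow> f j \<in> borel_measurable N"
  shows "(\<lambda>s. \<Sum>j\<in>J. u j v* f j s) \<in> borel_measurable N"
  by (intro borel_measurable_sum measurable_compose[OF assms] borel_measurable_continuous_onI
      continuous_on_vector_matrix_mult)

text \<open>A quantitative inverse of the exponential near 0: d exp (-d) is at most 1 - exp (-d),
  and c \<le> 1/2 keeps exp (-d) above 1/2. It recovers smallness of an exponent from closeness of a
  characteristic function to 1.\<close>

lemma le_of_abs_exp_minus_one_le:
  fixes d c :: real
  assumes "\<bar>exp (- d) - 1\<bar> \<le> c" "c \<le> 1 / 2" "0 \<le> d"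
  shows "d \<le> 2 * c"
proof -
  have e: "1 / 2 \<le> exp (- d)" using assms by linarith
  have "(1 + d) * exp (- d) \<le> exp d * exp (- d)"
    using exp_ge_add_one_self[of d] by (intro mult_right_mono) auto
  then have "(1 + d) * exp (- d) \<le> 1" by (simp add: exp_minus)
  then have "d * exp (- d) \<le> c" using assms by (simp add: algebra_simps)
  moreover have "d * (1 / 2) \<le> d * exp (- d)" using e assms by (intro mult_left_mono) auto
  ultimately show ?thesis by simp
qed

lemma sum_times_bool:
  "(\<Sum>z\<in>J \<times> (UNIV :: bool set). p z) = (\<Sum>j\<in>J. p (j, True) + p (j, False))"
proof -
  have "(\<Sum>z\<in>J \<times> (UNIV :: bool set). p z) = (\<Sum>(j, b)\<in>J \<times> UNIV. p (j, b))"
    by (intro sum.cong) auto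
  also have "\<dots> = (\<Sum>j\<in>J. \<Sum>b\<in>UNIV. p (j, b))" by (rule sum.cartesian_product[symmetric])
  finally show ?thesis by (simp add: UNIV_bool add.commute)
qed

text \<open>Along approximating simple integrands \<open>g n\<close> the integrals are Cauchy in probability, so
  \<open>\<integral> -\<psi>(g n - g m)\<close> tends to \<open>0\<close>; Fatou in \<open>m\<close> gives \<open>\<integral> -\<psi>(g n - h) \<longlonglongrightarrow> 0\<close> for the limit
  integrand \<open>h\<close>, whence \<open>\<integral> \<psi>(g n) \<longlonglongrightarrow> \<integral> \<psi>(h)\<close>.\<close>

lemma stoch_integral_char:
  fixes P :: "'w measure" and \<psi> :: "real^'d \<Rightarrow> real" and M :: "(real^'n) set \<Rightarrow> 'w \<Rightarrow> real^'d"
    and f :: "'j \<Rightarrow> real^'n \<Rightarrow> real^'d^'d" and X :: "'j \<Rightarrow> 'w \<Rightarrow> real^'d" and u :: "'j \<Rightarrow> real^'d"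
  assumes rm: "random_measure P \<psi> M"
    and \<psi>: "\<psi> 0 = 0" "\<And>v. \<psi> v \<le> 0" "\<And>v. \<psi> (- v) = \<psi> v" "continuous_on UNIV \<psi>"
      "\<And>\<epsilon> a b. 0 < \<epsilon> \<Longrightarrow> \<bar>\<psi> a - \<psi> b\<bar> \<le> - \<epsilon> * \<psi> b - (1 + 1 / \<epsilon>) * \<psi> (a - b)"
    and J: "finite J" and X: "\<And>j. j \<in> J \<Longrightarrow> has_stoch_integral P M (f j) (X j)"
  shows "integrable lborel (\<lambda>s. \<psi> (\<Sum>j\<in>J. u j v* f j s))"
    and "(CLINT \<omega>|P. iexp (\<Sum>j\<in>J. u j \<bullet> X j \<omega>)) =
      exp (complex_of_real (\<integral>s. \<psi> (\<Sum>j\<in>J. u j v* f j s) \<partial>lborel))"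
proof -
  interpret prob_space P using rm by (rule random_measure_prob_space)
  \<comment> \<open>The implication inside the existential makes it total in j, so that
    \<open>choice\<close> selects the approximations for all j at once.\<close>
  have "\<forall>j. \<exists>F. j \<in> J \<longrightarrow> (\<forall>k. Bochner_Integration.simple_bochner_integrable lborel (F k)) \<and>
      (AE s in lborel. (\<lambda>k. F k s) \<longlonglongrightarrow> f j s) \<and> conv_in_prob P (\<lambda>k. simple_stoch_integral M (F k)) (X j)"
    using X unfolding has_stoch_integral_def by blast
  from choice[OF this] obtain F where F:
    "\<And>j k. j \<in> J \<Longrightarrow> Bochner_Integration.simple_bochner_integrable lborel (F j k)"
    "\<And>j. j \<in> J \<Longrightarrow> AE s in lborel. (\<lambda>k. F j k s) \<longlonglongrightarrow> f j s"
    "\<And>j. j \<in> J \<Longrightarrow> conv_in_prob P (\<lambda>k. simple_stoch_integral M (F j k)) (X j)"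
    by blast
  have fm: "f j \<in> borel_measurable lborel" and Xm [measurable]: "X j \<in> borel_measurable P" if "j \<in> J" for j
    using X[OF that] by (auto simp: has_stoch_integral_def)
  have Fm: "F j k \<in> borel_measurable lborel" if "j \<in> J" for j k
    by (rule borel_measurable_simple_function) (use F(1)[OF that] in \<open>auto simp: simple_bochner_integrable.simps\<close>)
  have Im [measurable]: "simple_stoch_integral M (F j k) \<in> borel_measurable P" if "j \<in> J" for j k
    by (rule simple_stoch_integral_measurable[OF rm F(1)[OF that]])
  define g where "g n s = (\<Sum>j\<in>J. u j v* F j n s)" for n s
  define h where "h s = (\<Sum>j\<in>J. u j v* f j s)" for s
  have [measurable]: "h \<in> borel_measurable lborel" "\<And>n. g n \<in> borel_measurable lborel"
    unfolding h_def[abs_def] g_def[abs_def] by (intro vector_matrix_sum_measurable fm Fm; assumption)+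
  have [measurable]: "\<psi> \<in> borel_measurable borel" by (rule borel_measurable_continuous_onI[OF \<psi>(4)])
  have gh: "AE s in lborel. (\<lambda>n. g n s) \<longlonglongrightarrow> h s"
  proof -
    have "AE s in lborel. \<forall>j\<in>J. (\<lambda>k. F j k s) \<longlonglongrightarrow> f j s"
      using J F(2) by (intro AE_finite_allI)
    then show ?thesis
    proof eventually_elim
      case (elim s)
      have "(\<lambda>n. u j v* F j n s) \<longlonglongrightarrow> u j v* f j s" if "j \<in> J" for j
        by (rule continuous_on_tendsto_compose[OF continuous_on_vector_matrix_mult[of UNIV]])
          (use elim that in auto)
      then show ?case unfolding g_def h_def by (intro tendsto_sum)
    qed
  qed
  define S where "S n \<omega> = (\<Sum>j\<in>J. u j \<bullet> simple_stoch_integral M (F j n) \<omega>)" for n \<omega>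
  define T where "T \<omega> = (\<Sum>j\<in>J. u j \<bullet> X j \<omega>)" for \<omega>
  have [measurable]: "T \<in> borel_measurable P" "\<And>n. S n \<in> borel_measurable P"
    unfolding S_def[abs_def] T_def[abs_def] by measurable
  define e where "e n = (\<integral>\<omega>. cmod (iexp (S n \<omega>) - iexp (T \<omega>)) \<partial>P)" for n
  have intd: "integrable P (\<lambda>\<omega>. iexp (a \<omega>) - iexp (b \<omega>))"
    if [measurable]: "a \<in> borel_measurable P" "b \<in> borel_measurable P" for a b :: "'w \<Rightarrow> real"
    by (rule integrable_const_bound[where B=2]) (auto intro: norm_iexp_diff_le(2))
  have e0: "e \<longlonglongrightarrow> 0"
  proof (rule tendsto_sandwich[OF _ _ tendsto_const])
    let ?r = "\<lambda>n. \<Sum>j\<in>J. \<integral>\<omega>. cmod (iexp (u j \<bullet> simple_stoch_integral M (F j n) \<omega>) - iexp (u j \<bullet> X j \<omega>)) \<partial>P"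
    have "(\<lambda>n. ?r n) \<longlonglongrightarrow> (\<Sum>j\<in>J. 0)"
      by (intro tendsto_sum conv_in_prob_imp_iexp_L1[OF prob_space_axioms F(3)] Im Xm; assumption)
    then show "?r \<longlonglongrightarrow> 0" by simp
    have "e n \<le> ?r n" for n
    proof -
      have "e n \<le> (\<integral>\<omega>. (\<Sum>j\<in>J. cmod (iexp (u j \<bullet> simple_stoch_integral M (F j n) \<omega>) - iexp (u j \<bullet> X j \<omega>))) \<partial>P)"
        unfolding e_def
      proof (rule integral_mono)
        show "integrable P (\<lambda>\<omega>. cmod (iexp (S n \<omega>) - iexp (T \<omega>)))"
          by (intro integrable_norm intd) auto
        show "integrable P (\<lambda>\<omega>. \<Sum>j\<in>J. cmod (iexp (u j \<bullet> simple_stoch_integral M (F j n) \<omega>) - iexp (u j \<bullet> X j \<omega>)))"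
          by (intro Bochner_Integration.integrable_sum integrable_norm intd borel_measurable_inner borel_measurable_const Im Xm)
        fix \<omega>
        \<comment> \<open>The exponential of the sum is a product of numbers of modulus 1, and two
          such products differ by at most the sum of the differences of their factors.\<close>
        have *: "iexp (\<Sum>j\<in>J. a j) = (\<Prod>j\<in>J. iexp (a j))" for a :: "'j \<Rightarrow> real"
          using J by (simp add: exp_sum[symmetric] sum_distrib_left)
        show "cmod (iexp (S n \<omega>) - iexp (T \<omega>)) \<le>
          (\<Sum>j\<in>J. cmod (iexp (u j \<bullet> simple_stoch_integral M (F j n) \<omega>) - iexp (u j \<bullet> X j \<omega>)))"
          unfolding S_def T_def * by (rule norm_prod_diff) auto
      qed
      also have "\<dots> = ?r n"
        by (intro Bochner_Integration.integral_sum integrable_norm intd borel_measurable_inner borel_measurable_const Im Xm)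
      finally show ?thesis .
    qed
    then show "\<forall>\<^sub>F n in sequentially. e n \<le> ?r n" by simp
    show "\<forall>\<^sub>F n in sequentially. 0 \<le> e n" by (simp add: e_def integral_nonneg_AE)
  qed
  have Sn: "integrable lborel (\<lambda>s. \<psi> (g n s))"
    "(CLINT \<omega>|P. iexp (S n \<omega>)) = exp (complex_of_real (\<integral>s. \<psi> (g n s) \<partial>lborel))" for n
    unfolding g_def S_def by (intro simple_stoch_integral_char[OF rm J F(1) \<psi>(1)]; assumption)+
  have Snm: "integrable lborel (\<lambda>s. \<psi> (g n s - g m s))" (is ?A)
    "(CLINT \<omega>|P. iexp (S n \<omega> - S m \<omega>)) = exp (complex_of_real (\<integral>s. \<psi> (g n s - g m s) \<partial>lborel))" (is ?B) for n m
  proof -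
    \<comment> \<open>A difference of integrals is a single linear combination over two copies of \<open>J\<close>.\<close>
    define J' where "J' = J \<times> (UNIV :: bool set)"
    define F' where "F' = (\<lambda>(j, b). if b then F j n else F j m)"
    define u' where "u' = (\<lambda>(j, b). if b then u j else - u j)"
    have J': "finite J'" using J by (simp add: J'_def)
    have F': "Bochner_Integration.simple_bochner_integrable lborel (F' z)" if "z \<in> J'" for z
      using that F(1) by (auto simp: J'_def F'_def)
    have neg: "(- x) v* A = - (x v* A)" for x :: "real^'d" and A :: "real^'d^'d"
      by (simp add: vector_matrix_mult_def vec_eq_iff sum_negf)
    have 1: "(\<Sum>z\<in>J'. u' z v* F' z s) = g n s - g m s" for s
      unfolding J'_def g_def
      by (simp add: sum_times_bool u'_def F'_def neg sum_subtractf)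
    have 2: "(\<Sum>z\<in>J'. u' z \<bullet> simple_stoch_integral M (F' z) \<omega>) = S n \<omega> - S m \<omega>" for \<omega>
      unfolding J'_def S_def
      by (simp add: sum_times_bool u'_def F'_def sum_subtractf)
    have "integrable lborel (\<lambda>s. \<psi> (\<Sum>z\<in>J'. u' z v* F' z s))"
      by (rule simple_stoch_integral_char(1)[OF rm J' F' \<psi>(1)])
    then show ?A unfolding 1 .
    have "(CLINT \<omega>|P. iexp (\<Sum>z\<in>J'. u' z \<bullet> simple_stoch_integral M (F' z) \<omega>)) =
        exp (complex_of_real (\<integral>s. \<psi> (\<Sum>z\<in>J'. u' z v* F' z s) \<partial>lborel))"
      by (rule simple_stoch_integral_char(2)[OF rm J' F' \<psi>(1)])
    then show ?B unfolding 1 2 .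
  qed
  define d where "d n m = - (\<integral>s. \<psi> (g n s - g m s) \<partial>lborel)" for n m
  have d_nonneg: "0 \<le> d n m" for n m
    unfolding d_def using \<psi>(2) by (simp add: integral_nonneg_AE flip: Bochner_Integration.integral_minus)
  have d_le: "d n m \<le> 2 * (e n + e m)" if "e n + e m \<le> 1 / 2" for n m
  proof (rule le_of_abs_exp_minus_one_le[OF _ that d_nonneg])
    have "(CLINT \<omega>|P. iexp (S n \<omega> - S m \<omega>) - iexp 0) =
        (CLINT \<omega>|P. iexp (S n \<omega> - S m \<omega>)) - (CLINT \<omega>|P. iexp 0)"
      by (intro Bochner_Integration.integral_diff integrable_const_bound[where B=1]) auto
    also have "\<dots> = complex_of_real (exp (- d n m) - 1)"
      unfolding Snm(2) d_def by (simp add: prob_space exp_of_real)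
    finally have "complex_of_real (exp (- d n m) - 1) = (CLINT \<omega>|P. iexp (S n \<omega> - S m \<omega>) - iexp 0)" ..
    then have "\<bar>exp (- d n m) - 1\<bar> = cmod (CLINT \<omega>|P. iexp (S n \<omega> - S m \<omega>) - iexp 0)"
      by (metis norm_of_real)
    also have "\<dots> \<le> (\<integral>\<omega>. cmod (iexp (S n \<omega> - S m \<omega>) - iexp 0) \<partial>P)"
      by (rule integral_norm_bound)
    also have "\<dots> \<le> (\<integral>\<omega>. cmod (iexp (S n \<omega>) - iexp (T \<omega>)) + cmod (iexp (S m \<omega>) - iexp (T \<omega>)) \<partial>P)"
    proof (rule integral_mono)
      fix \<omega>
      \<comment> \<open>Multiplication by a number of modulus 1 turns the distance of the
        exponential of a difference from 1 into a distance between two exponentials, to be compared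
        through \<open>T\<close>.\<close>
      have "iexp (S n \<omega>) - iexp (S m \<omega>) = iexp (S m \<omega>) * (iexp (S n \<omega> - S m \<omega>) - iexp 0)"
        by (simp add: exp_diff field_simps)
      then have "cmod (iexp (S n \<omega> - S m \<omega>) - iexp 0) = cmod (iexp (S n \<omega>) - iexp (S m \<omega>))"
        by (simp add: norm_mult)
      also have "\<dots> \<le> cmod (iexp (S n \<omega>) - iexp (T \<omega>)) + cmod (iexp (S m \<omega>) - iexp (T \<omega>))"
        by (metis dist_norm dist_triangle2)
      finally show "cmod (iexp (S n \<omega> - S m \<omega>) - iexp 0) \<le> cmod (iexp (S n \<omega>) - iexp (T \<omega>)) + cmod (iexp (S m \<omega>) - iexp (T \<omega>))" .
    qed (intro integrable_norm intd Bochner_Integration.integrable_add; measurable)+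
    also have "\<dots> = e n + e m"
      unfolding e_def by (intro Bochner_Integration.integral_add integrable_norm intd) auto
    finally show "\<bar>exp (- d n m) - 1\<bar> \<le> e n + e m" .
  qed
  define b where "b n = - (\<integral>s. \<psi> (h s - g n s) \<partial>lborel)" for n
  \<comment> \<open>With \<eta> \<le> 1/4 both errors together are at most 1/2, as
    \<open>d_le\<close> requires; twice the sum of two errors of size \<eta> gives 4 \<eta>.
    Evenness of \<psi> permits exchanging the order of subtraction in the limit.\<close>
  have fatou: "integrable lborel (\<lambda>s. \<psi> (h s - g n s)) \<and> b n \<le> 4 * \<eta>"
    if \<eta>: "0 < \<eta>" "\<eta> \<le> 1 / 4" and n: "e n \<le> \<eta>" for n \<eta>
  proof -
    have [measurable]: "(\<lambda>s. h s - g n s) \<in> borel_measurable lborel" by measurable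
    have "(\<integral>\<^sup>+s. ennreal (- \<psi> (h s - g n s)) \<partial>lborel) =
      (\<integral>\<^sup>+s. liminf (\<lambda>m. ennreal (- \<psi> (g n s - g m s))) \<partial>lborel)"
    proof (rule nn_integral_cong_AE)
      show "AE s in lborel. ennreal (- \<psi> (h s - g n s)) = liminf (\<lambda>m. ennreal (- \<psi> (g n s - g m s)))"
        using gh
      proof eventually_elim
        case (elim s)
        have "(\<lambda>m. \<psi> (g n s - g m s)) \<longlonglongrightarrow> \<psi> (g n s - h s)"
          by (rule continuous_on_tendsto_compose[OF \<psi>(4)]) (auto intro!: tendsto_intros elim)
        then have "(\<lambda>m. ennreal (- \<psi> (g n s - g m s))) \<longlonglongrightarrow> ennreal (- \<psi> (g n s - h s))"
          by (intro tendsto_ennrealI tendsto_minus)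
        moreover have "\<psi> (h s - g n s) = \<psi> (g n s - h s)" using \<psi>(3)[of "g n s - h s"] by simp
        ultimately show ?case using lim_imp_Liminf[OF sequentially_bot] by metis
      qed
    qed
    also have "\<dots> \<le> liminf (\<lambda>m. \<integral>\<^sup>+s. ennreal (- \<psi> (g n s - g m s)) \<partial>lborel)"
      by (rule nn_integral_liminf) measurable
    also have "\<dots> \<le> ennreal (4 * \<eta>)"
    proof (rule Liminf_le[OF sequentially_bot])
      have "\<forall>\<^sub>F m in sequentially. e m < \<eta>" using order_tendstoD(2)[OF e0 \<eta>(1)] .
      then show "\<forall>\<^sub>F m in sequentially. (\<integral>\<^sup>+s. ennreal (- \<psi> (g n s - g m s)) \<partial>lborel) \<le> ennreal (4 * \<eta>)"
      proof eventually_elim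
        case (elim m)
        have "d n m \<le> 2 * (e n + e m)" using elim n \<eta> by (intro d_le) linarith
        then have dle: "d n m \<le> 4 * \<eta>" using elim n by argo
        have "(\<integral>\<^sup>+s. ennreal (- \<psi> (g n s - g m s)) \<partial>lborel) = ennreal (d n m)"
          unfolding d_def Bochner_Integration.integral_minus[symmetric]
          using Snm(1) \<psi>(2) by (intro nn_integral_eq_integral) auto
        then show ?case using dle by (simp add: ennreal_leI)
      qed
    qed
    finally have le: "(\<integral>\<^sup>+s. ennreal (- \<psi> (h s - g n s)) \<partial>lborel) \<le> ennreal (4 * \<eta>)" .
    have int: "integrable lborel (\<lambda>s. - \<psi> (h s - g n s))"
      using le \<psi>(2) by (intro integrableI_nonneg) (auto simp: top_unique less_top[symmetric])
    have "ennreal (b n) = (\<integral>\<^sup>+s. ennreal (- \<psi> (h s - g n s)) \<partial>lborel)"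
      unfolding b_def Bochner_Integration.integral_minus[symmetric]
      using int \<psi>(2) by (intro nn_integral_eq_integral[symmetric]) auto
    with le have "ennreal (b n) \<le> ennreal (4 * \<eta>)" by simp
    then have "b n \<le> 4 * \<eta>" using \<eta>(1) by (subst (asm) ennreal_le_iff) auto
    then show ?thesis using Bochner_Integration.integrable_minus[OF int] by simp
  qed
  \<comment> \<open>Integrability is asserted only eventually, since the Fatou bound needs
    \<open>e n \<le> 1 / 4\<close>.\<close>
  have intb: "\<forall>\<^sub>F n in sequentially. integrable lborel (\<lambda>s. \<psi> (h s - g n s))"
    using order_tendstoD(2)[OF e0, of "1 / 4"] by (rule eventually_mono) (use fatou[of "1 / 4"] in auto)
  have b_nonneg: "0 \<le> b n" for n
    unfolding b_def using \<psi>(2) by (simp add: integral_nonneg_AE flip: Bochner_Integration.integral_minus)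
  have b0: "b \<longlonglongrightarrow> 0"
  proof (rule order_tendstoI)
    fix a :: real assume "0 < a"
    define \<eta> where "\<eta> = min (1 / 4) (a / 8)"
    have \<eta>: "0 < \<eta>" "\<eta> \<le> 1 / 4" "4 * \<eta> < a" using \<open>0 < a\<close> by (auto simp: \<eta>_def min_def)
    from order_tendstoD(2)[OF e0 \<eta>(1)] show "\<forall>\<^sub>F n in sequentially. b n < a"
    proof (rule eventually_mono)
      fix n assume "e n < \<eta>"
      then have "b n \<le> 4 * \<eta>" using fatou[OF \<eta>(1,2), of n] by simp
      then show "b n < a" using \<eta>(3) by (rule le_less_trans)
    qed
  next
    fix a :: real assume "a < 0"
    then show "\<forall>\<^sub>F n in sequentially. a < b n" using b_nonneg by (auto intro: always_eventually less_le_trans)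
  qed
  \<comment> \<open>A single good n suffices: the difference bound with \<epsilon> = 1 dominates
    \<psi> (h s) by \<psi> of a simple function and \<psi> of the remainder.\<close>
  have int_h: "integrable lborel (\<lambda>s. \<psi> (h s))"
  proof -
    from intb obtain n where n: "integrable lborel (\<lambda>s. \<psi> (h s - g n s))"
      by (auto simp: eventually_sequentially)
    have "integrable lborel (\<lambda>s. - 2 * \<psi> (g n s) - 2 * \<psi> (h s - g n s))"
      by (intro Bochner_Integration.integrable_diff integrable_mult_right Sn n)
    then show ?thesis
    proof (rule Bochner_Integration.integrable_bound)
      show "AE s in lborel. norm (\<psi> (h s)) \<le> norm (- 2 * \<psi> (g n s) - 2 * \<psi> (h s - g n s))"
      proof (rule AE_I2)
        fix s
        have "\<bar>\<psi> (h s) - \<psi> (g n s)\<bar> \<le> - \<psi> (g n s) - 2 * \<psi> (h s - g n s)"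
          using \<psi>(5)[of 1 "h s" "g n s"] by simp
        then show "norm (\<psi> (h s)) \<le> norm (- 2 * \<psi> (g n s) - 2 * \<psi> (h s - g n s))"
          using \<psi>(2)[of "h s"] \<psi>(2)[of "g n s"] \<psi>(2)[of "h s - g n s"] by simp
      qed
    qed measurable
  qed
  have conv: "(\<lambda>n. \<integral>s. \<psi> (g n s) \<partial>lborel) \<longlonglongrightarrow> (\<integral>s. \<psi> (h s) \<partial>lborel)"
  proof (rule LIMSEQ_I)
    fix r :: real assume r: "0 < r"
    define a where "a = - (\<integral>s. \<psi> (h s) \<partial>lborel)"
    have a: "0 \<le> a"
      unfolding a_def using \<psi>(2) by (simp add: integral_nonneg_AE flip: Bochner_Integration.integral_minus)
    \<comment> \<open>Half of \<open>r\<close> is reserved for \<epsilon> a, with a + 1 in place of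
      a since a may be 0. As \<epsilon> is then fixed, the factor 1 + 1/\<epsilon> is harmless
      against \<open>b n\<close> tending to 0.\<close>
    define \<epsilon> where "\<epsilon> = r / (2 * (a + 1))"
    have \<epsilon>: "0 < \<epsilon>" using r a by (simp add: \<epsilon>_def)
    have \<epsilon>a: "\<epsilon> * a \<le> r / 2"
    proof -
      have "\<epsilon> * a \<le> \<epsilon> * (a + 1)" using \<epsilon> by simp
      also have "\<dots> = r / 2" using a by (simp only: \<epsilon>_def) (simp add: field_simps)
      finally show ?thesis .
    qed
    have le: "\<bar>(\<integral>s. \<psi> (g n s) \<partial>lborel) - (\<integral>s. \<psi> (h s) \<partial>lborel)\<bar> \<le> \<epsilon> * a + (1 + 1 / \<epsilon>) * b n"
      if n: "integrable lborel (\<lambda>s. \<psi> (h s - g n s))" for n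
    proof -
      have "\<bar>(\<integral>s. \<psi> (g n s) \<partial>lborel) - (\<integral>s. \<psi> (h s) \<partial>lborel)\<bar> = \<bar>\<integral>s. \<psi> (g n s) - \<psi> (h s) \<partial>lborel\<bar>"
        by (subst Bochner_Integration.integral_diff[OF Sn(1) int_h]) simp
      also have "\<dots> \<le> (\<integral>s. \<bar>\<psi> (g n s) - \<psi> (h s)\<bar> \<partial>lborel)" by (rule integral_abs_bound)
      \<comment> \<open>The inequality is used with base point \<open>h\<close>, so that the
        \<epsilon>-term is a multiple of an integral that does not depend on n.\<close>
      also have "\<dots> \<le> (\<integral>s. - \<epsilon> * \<psi> (h s) - (1 + 1 / \<epsilon>) * \<psi> (h s - g n s) \<partial>lborel)"
      proof (rule integral_mono)
        show "\<bar>\<psi> (g n s) - \<psi> (h s)\<bar> \<le> - \<epsilon> * \<psi> (h s) - (1 + 1 / \<epsilon>) * \<psi> (h s - g n s)" for s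
          using \<psi>(5)[OF \<epsilon>, of "g n s" "h s"] \<psi>(3)[of "g n s - h s"] by simp
      qed (intro integrable_abs Bochner_Integration.integrable_diff integrable_mult_right Sn int_h n)+
      also have "\<dots> = \<epsilon> * a + (1 + 1 / \<epsilon>) * b n"
        unfolding a_def b_def
        by (subst Bochner_Integration.integral_diff) (intro integrable_mult_right int_h n, intro integrable_mult_right int_h n, simp)
      finally show ?thesis .
    qed
    have "(\<lambda>n. (1 + 1 / \<epsilon>) * b n) \<longlonglongrightarrow> 0" using tendsto_mult_left[OF b0, of "1 + 1 / \<epsilon>"] by simp
    then have "\<forall>\<^sub>F n in sequentially. (1 + 1 / \<epsilon>) * b n < r / 2" using r by (intro order_tendstoD(2)) auto
    with intb have "\<forall>\<^sub>F n in sequentially. norm ((\<integral>s. \<psi> (g n s) \<partial>lborel) - (\<integral>s. \<psi> (h s) \<partial>lborel)) < r"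
    proof eventually_elim
      case (elim n)
      then show ?case using le[of n] \<epsilon>a unfolding real_norm_def by linarith
    qed
    then show "\<exists>no. \<forall>n\<ge>no. norm ((\<integral>s. \<psi> (g n s) \<partial>lborel) - (\<integral>s. \<psi> (h s) \<partial>lborel)) < r"
      by (simp add: eventually_sequentially)
  qed
  show "integrable lborel (\<lambda>s. \<psi> (\<Sum>j\<in>J. u j v* f j s))" using int_h by (simp add: h_def)
  have "(\<lambda>n. CLINT \<omega>|P. iexp (S n \<omega>)) \<longlonglongrightarrow> exp (complex_of_real (\<integral>s. \<psi> (h s) \<partial>lborel))"
    unfolding Sn by (intro tendsto_intros conv)
  moreover have "(\<lambda>n. CLINT \<omega>|P. iexp (S n \<omega>)) \<longlonglongrightarrow> (CLINT \<omega>|P. iexp (T \<omega>))"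
  proof (rule Lim_transform[OF tendsto_const])
    show "(\<lambda>n. (CLINT \<omega>|P. iexp (S n \<omega>)) - (CLINT \<omega>|P. iexp (T \<omega>))) \<longlonglongrightarrow> 0"
    proof (rule Lim_null_comparison[OF always_eventually e0], rule allI)
      fix n
      have "(CLINT \<omega>|P. iexp (S n \<omega>)) - (CLINT \<omega>|P. iexp (T \<omega>)) = (CLINT \<omega>|P. iexp (S n \<omega>) - iexp (T \<omega>))"
        by (intro Bochner_Integration.integral_diff[symmetric] integrable_const_bound[where B=1]) auto
      also have "cmod \<dots> \<le> (\<integral>\<omega>. cmod (iexp (S n \<omega>) - iexp (T \<omega>)) \<partial>P)" by (rule integral_norm_bound)
      also have "\<dots> = e n" by (simp add: e_def)
      finally show "cmod ((CLINT \<omega>|P. iexp (S n \<omega>)) - (CLINT \<omega>|P. iexp (T \<omega>))) \<le> e n" .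
    qed
  qed
  ultimately have "(CLINT \<omega>|P. iexp (T \<omega>)) = exp (complex_of_real (\<integral>s. \<psi> (h s) \<partial>lborel))"
    using LIMSEQ_unique by blast
  then show "(CLINT \<omega>|P. iexp (\<Sum>j\<in>J. u j \<bullet> X j \<omega>)) =
      exp (complex_of_real (\<integral>s. \<psi> (\<Sum>j\<in>J. u j v* f j s) \<partial>lborel))"
    by (simp only: T_def h_def)
qed

section \<open>The continuity theorem in several dimensions\<close>

text \<open>Trigonometric polynomials in the first k arguments. Products are not among the rules, so
  that convergence of expectations follows from convergence of characteristic functions by linearity
  alone. Points are functions on all of nat, which makes them elements of one topological space for
  every k.\<close>

inductive_set trig_polys :: "nat \<Rightarrow> ((nat \<Rightarrow> 'a::euclidean_space) \<Rightarrow> complex) set" for k where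
  exp: "(\<lambda>x. iexp (\<Sum>i<k. u i \<bullet> x i)) \<in> trig_polys k"
| scale: "f \<in> trig_polys k \<Longrightarrow> (\<lambda>x. c * f x) \<in> trig_polys k"
| add: "f \<in> trig_polys k \<Longrightarrow> g \<in> trig_polys k \<Longrightarrow> (\<lambda>x. f x + g x) \<in> trig_polys k"

lemma trig_polys_const: "(\<lambda>x. c) \<in> trig_polys k"
  using trig_polys.scale[OF trig_polys.exp[where u="\<lambda>_. 0" and k=k], of c] by simp

lemma trig_polys_mult:
  assumes "f \<in> trig_polys k" "g \<in> trig_polys k"
  shows "(\<lambda>x. f x * g x) \<in> trig_polys k"
  using assms(1)
proof induction
  case (exp u)
  show ?case using assms(2)
  proof induction
    case (exp v)
    have "(\<lambda>x. iexp (\<Sum>i<k. u i \<bullet> x i) * iexp (\<Sum>i<k. v i \<bullet> x i)) =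
      (\<lambda>x. iexp (\<Sum>i<k. (u i + v i) \<bullet> x i))"
      by (simp add: exp_add[symmetric] inner_add_left sum.distrib distrib_left)
    then show ?case by (simp only: trig_polys.exp)
  next
    case (scale f c)
    then show ?case using trig_polys.scale by (simp add: mult.left_commute[of _ c])
  next
    case (add f g)
    then show ?case by (simp add: trig_polys.add distrib_left)
  qed
next
  case (scale f c)
  then show ?case by (simp add: trig_polys.scale mult.assoc)
next
  case (add f g)
  then show ?case by (simp add: trig_polys.add distrib_right)
qed

lemma trig_polys_sin:
  assumes "i < k"
  shows "(\<lambda>x. complex_of_real (sin (v \<bullet> x i))) \<in> trig_polys k"
proof -
  have e: "(\<lambda>x. iexp (w \<bullet> x i)) \<in> trig_polys k" for w :: 'a
  proof -
    have "(\<Sum>j<k. (if j = i then w else 0) \<bullet> x j) = w \<bullet> x i" for x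
      using assms by (simp add: if_distrib[of "\<lambda>a. a \<bullet> _"] cong: if_cong)
    then show ?thesis using trig_polys.exp[where k=k and u="\<lambda>j. if j = i then w else 0"] by simp
  qed
  have "complex_of_real (sin z) = (1/(2*\<i>)) * iexp z + (-1/(2*\<i>)) * iexp (-z)" for z
    by (simp add: sin_of_real[symmetric] sin_exp_eq field_simps)
  then have "(\<lambda>x. complex_of_real (sin (v \<bullet> x i))) =
     (\<lambda>x. (1/(2*\<i>)) * iexp (v \<bullet> x i) + (-1/(2*\<i>)) * iexp ((-v) \<bullet> x i))"
    by (simp only: inner_minus_left)
  then show ?thesis by (simp only: trig_polys.add[OF trig_polys.scale[OF e] trig_polys.scale[OF e]])
qed

lemma trig_polys_integrable:
  fixes X :: "nat \<Rightarrow> 'w \<Rightarrow> 'a::euclidean_space"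
  assumes "prob_space P" and m [measurable]: "\<And>i. X i \<in> borel_measurable P"
    and f: "f \<in> trig_polys k"
  shows "complex_integrable P (\<lambda>\<omega>. f (\<lambda>i. X i \<omega>))"
proof -
  interpret prob_space P by fact
  show ?thesis using f
    by induction (auto intro!: integrable_const_bound[where B=1])
qed

lemma trig_polys_integral_tendsto:
  fixes X :: "nat \<Rightarrow> nat \<Rightarrow> 'w \<Rightarrow> 'a::euclidean_space" and Y :: "nat \<Rightarrow> 'v \<Rightarrow> 'a"
  assumes P: "\<And>n. prob_space (P n)" "prob_space Q"
    and m: "\<And>n i. X n i \<in> borel_measurable (P n)" "\<And>i. Y i \<in> borel_measurable Q"
    and char: "\<And>u. (\<lambda>n. CLINT \<omega>|P n. iexp (\<Sum>i<k. u i \<bullet> X n i \<omega>)) \<longlonglongrightarrow>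
       (CLINT \<omega>|Q. iexp (\<Sum>i<k. u i \<bullet> Y i \<omega>))"
    and f: "f \<in> trig_polys k"
  shows "(\<lambda>n. CLINT \<omega>|P n. f (\<lambda>i. X n i \<omega>)) \<longlonglongrightarrow> (CLINT \<omega>|Q. f (\<lambda>i. Y i \<omega>))"
  using f
proof induction
  case (exp u)
  then show ?case using char by simp
next
  case (scale f c)
  then show ?case by (auto intro: tendsto_mult_left)
next
  case (add f g)
  have "complex_integrable (P n) (\<lambda>\<omega>. f (\<lambda>i. X n i \<omega>))" if "f \<in> trig_polys k" for f n
    by (rule trig_polys_integrable[of "P n" "X n"]) (rule P m that)+
  moreover have "complex_integrable Q (\<lambda>\<omega>. f (\<lambda>i. Y i \<omega>))" if "f \<in> trig_polys k" for f
    by (rule trig_polys_integrable[of Q Y]) (rule P m that)+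
  ultimately show ?case using add by (simp add: tendsto_add)
qed

text \<open>Stone-Weierstrass for the ring of those continuous \<open>g\<close> that become
  trigonometric polynomials after substituting sines. Coordinates belong to it, because a sine is a
  combination of two exponentials, and they separate points. Fixing the arguments beyond k to 0
  makes \<open>S\<close> compact by Tychonoff and ensures that distinct points of \<open>S\<close>
  differ in some argument below k.\<close>

lemma trig_polys_dense:
  fixes f :: "(nat \<Rightarrow> 'a::euclidean_space) \<Rightarrow> real" and k :: nat
  defines "S \<equiv> {y. \<forall>i. y i \<in> (if i < k then cbox (-One) One else {0})}"
  assumes f: "continuous_on S f" and e: "0 < e"
  obtains g where
    "(\<lambda>x. complex_of_real (g (\<lambda>i. if i < k then \<Sum>b\<in>Basis. sin (c * (x i \<bullet> b)) *\<^sub>R b else 0))) \<in> trig_polys k"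
    "\<And>y. y \<in> S \<Longrightarrow> \<bar>f y - g y\<bar> < e"
proof -
  let ?s = "\<lambda>x i. if i < k then \<Sum>b\<in>Basis. sin (c * (x i \<bullet> b)) *\<^sub>R b else (0::'a)"
  define R where "R = {g. continuous_on S g \<and> (\<lambda>x. complex_of_real (g (?s x))) \<in> trig_polys k}"
  interpret function_ring_on R S
  proof
    have "compactin (product_topology (\<lambda>_. euclidean) UNIV)
      (PiE UNIV (\<lambda>i. if i < k then cbox (-One) One else {0::'a}))"
      by (subst compactin_PiE) auto
    moreover have "PiE UNIV (\<lambda>i. if i < k then cbox (-One) One else {0::'a}) = S"
      by (auto simp: S_def PiE_def Pi_def)
    ultimately show "compact S"
      by (simp add: euclidean_product_topology)
  next
    fix x y assume xy: "x \<in> S" "y \<in> S" "x \<noteq> y"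
    then obtain i where i: "x i \<noteq> y i" by blast
    have "x i = 0 \<and> y i = 0" if "\<not> i < k"
      using xy(1,2) that unfolding S_def mem_Collect_eq by (metis singletonD)
    with i have ik: "i < k" by metis
    from i obtain b where b: "b \<in> Basis" "x i \<bullet> b \<noteq> y i \<bullet> b"
      using euclidean_eqI by blast
    have "continuous_on S (\<lambda>z. z i \<bullet> b)"
      by (intro continuous_intros) (rule continuous_on_subset[OF continuous_on_product_coordinates], simp)
    moreover have "?s z i \<bullet> b = sin (c * (z i \<bullet> b))" for z
      using b ik by (simp add: inner_sum_left inner_Basis if_distrib cong: if_cong)
    then have "?s z i \<bullet> b = sin ((c *\<^sub>R b) \<bullet> z i)" for z
      by (simp add: inner_commute)
    ultimately have "(\<lambda>z. z i \<bullet> b) \<in> R"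
      unfolding R_def using trig_polys_sin[OF ik, of "c *\<^sub>R b"] by simp
    then show "\<exists>f\<in>R. f x \<noteq> f y" using b by (intro bexI) auto
  qed (auto simp: R_def intro: continuous_intros trig_polys.add trig_polys_mult trig_polys_const)
  from Stone_Weierstrass_basic[OF f e] obtain g where "g \<in> R" "\<forall>x\<in>S. \<bar>f x - g x\<bar> < e" by auto
  then show ?thesis by (intro that[of g]) (auto simp: R_def)
qed

text \<open>Tightness in one dimension: Levy's theorem gives weak convergence, and the tails of the
  limit law transfer to almost all members of the sequence. One threshold serves both.\<close>

lemma char_tendsto_imp_tails:
  fixes X :: "nat \<Rightarrow> 'w \<Rightarrow> real" and Y :: "'v \<Rightarrow> real"
  assumes P: "\<And>n. prob_space (P n)" "prob_space Q"
    and m [measurable]: "\<And>n. X n \<in> borel_measurable (P n)" "Y \<in> borel_measurable Q"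
    and char: "\<And>t. (\<lambda>n. CLINT \<omega>|P n. iexp (t * X n \<omega>)) \<longlonglongrightarrow> (CLINT \<omega>|Q. iexp (t * Y \<omega>))"
    and e: "0 < e"
  obtains r where "measure Q {\<omega>\<in>space Q. r < \<bar>Y \<omega>\<bar>} < e"
    "\<forall>\<^sub>F n in sequentially. measure (P n) {\<omega>\<in>space (P n). r < \<bar>X n \<omega>\<bar>} < e"
proof -
  interpret P: prob_space "P n" for n by fact
  interpret Q: prob_space Q by fact
  define \<mu> where "\<mu> n = distr (P n) borel (X n)" for n
  define \<nu> where "\<nu> = distr Q borel Y"
  have \<mu>: "real_distribution (\<mu> n)" for n
    unfolding \<mu>_def by (rule P.real_distribution_distr) measurable
  have \<nu>: "real_distribution \<nu>"
    unfolding \<nu>_def by (rule Q.real_distribution_distr) measurable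
  interpret \<nu>: real_distribution \<nu> by (rule \<nu>)
  have "(\<lambda>n. char (\<mu> n) t) \<longlonglongrightarrow> char \<nu> t" for t
    unfolding char_def \<mu>_def \<nu>_def using char[of t] by (simp add: integral_distr)
  then have w: "weak_conv_m \<mu> \<nu>"
    using levy_continuity[OF \<mu> \<nu>] by simp
  have "(\<lambda>n::nat. measure \<nu> {x. real n < \<bar>x\<bar>}) \<longlonglongrightarrow> measure \<nu> (\<Inter>n::nat. {x. real n < \<bar>x\<bar>})"
    by (rule \<nu>.finite_Lim_measure_decseq) (auto simp: decseq_def)
  moreover have "(\<Inter>n::nat. {x::real. real n < \<bar>x\<bar>}) = {}"
    by (auto simp: not_less) (meson real_arch_simple not_less)
  ultimately have "(\<lambda>n::nat. measure \<nu> {x. real n < \<bar>x\<bar>}) \<longlonglongrightarrow> 0" by simp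
  from order_tendstoD(2)[OF this e] obtain N :: nat where N: "measure \<nu> {x. real N < \<bar>x\<bar>} < e"
    by (auto simp: eventually_sequentially)
  \<comment> \<open>A continuous ramp lying between the indicators of the tails beyond N + 1 and
    beyond N. Continuity makes it a test function for weak convergence; the price is the final
    threshold N + 1.\<close>
  define g :: "real \<Rightarrow> real" where "g x = min 1 (max 0 (\<bar>x\<bar> - real N))" for x
  have [measurable]: "g \<in> borel_measurable borel" unfolding g_def by measurable
  have g: "\<And>x. 0 \<le> g x" "\<And>x. g x \<le> 1" by (auto simp: g_def)
  have ind: "indicator {x. real N + 1 < \<bar>x\<bar>} x \<le> g x" "g x \<le> indicator {x. real N < \<bar>x\<bar>} x" for x
    by (auto simp: g_def indicator_def)
  have "(\<lambda>n. integral\<^sup>L (\<mu> n) g) \<longlonglongrightarrow> integral\<^sup>L \<nu> g"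
  proof (rule weak_conv_imp_integral_bdd_continuous_conv[OF _ _ w, where B=1])
    show "isCont g x" for x unfolding g_def by (intro continuous_intros)
  qed (use g \<mu> \<nu> in \<open>auto simp: abs_le_iff intro: order_trans[of _ 0]\<close>)
  moreover have "integral\<^sup>L \<nu> g \<le> integral\<^sup>L \<nu> (indicator {x. real N < \<bar>x\<bar>})"
    using g by (intro integral_mono \<nu>.integrable_const_bound[where B=1] ind) auto
  ultimately have ev: "\<forall>\<^sub>F n in sequentially. integral\<^sup>L (\<mu> n) g < e"
    using N by (intro order_tendstoD(2)[of _ "integral\<^sup>L \<nu> g"]) auto
  have le: "measure (P n) {\<omega>\<in>space (P n). real N + 1 < \<bar>X n \<omega>\<bar>} \<le> integral\<^sup>L (\<mu> n) g" for n
  proof -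
    interpret \<mu>: real_distribution "\<mu> n" by (rule \<mu>)
    have "measure (P n) {\<omega>\<in>space (P n). real N + 1 < \<bar>X n \<omega>\<bar>} = measure (\<mu> n) {x. real N + 1 < \<bar>x\<bar>}"
      unfolding \<mu>_def by (subst measure_distr) (auto intro!: arg_cong[where f="measure (P n)"])
    also have "\<dots> = integral\<^sup>L (\<mu> n) (indicator {x. real N + 1 < \<bar>x\<bar>})" by simp
    also have "\<dots> \<le> integral\<^sup>L (\<mu> n) g"
      using g by (intro integral_mono \<mu>.integrable_const_bound[where B=1] ind) auto
    finally show ?thesis .
  qed
  from ev have "\<forall>\<^sub>F n in sequentially. measure (P n) {\<omega>\<in>space (P n). real N + 1 < \<bar>X n \<omega>\<bar>} < e"
    by eventually_elim (rule le_less_trans[OF le])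
  moreover have "measure Q {\<omega>\<in>space Q. real N + 1 < \<bar>Y \<omega>\<bar>} < e"
  proof -
    have "measure Q {\<omega>\<in>space Q. real N + 1 < \<bar>Y \<omega>\<bar>} \<le> measure Q {\<omega>\<in>space Q. real N < \<bar>Y \<omega>\<bar>}"
      by (rule Q.finite_measure_mono) auto
    also have "\<dots> = measure \<nu> {x. real N < \<bar>x\<bar>}"
      unfolding \<nu>_def by (subst measure_distr) (auto intro!: arg_cong[where f="measure Q"])
    finally show ?thesis using N by simp
  qed
  ultimately show ?thesis by (intro that[of "real N + 1"])
qed

text \<open>The map \<open>x \<mapsto> arcsin (sin (c * x)) / c\<close> with \<open>c = pi / (2 * R)\<close> is the identity on \<open>[-R, R]\<close> and
  periodic, so polynomials in sines that approximate \<open>h\<close> on a cube remain bounded outside of it.\<close>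

lemma trig_polys_approx:
  fixes h :: "(nat \<Rightarrow> 'a::euclidean_space) \<Rightarrow> real"
  assumes h: "continuous_on UNIV h" "\<And>x. \<bar>h x\<bar> \<le> B" and e: "0 < e" and R: "0 < R"
  obtains p where "p \<in> trig_polys k"
    "\<And>x. \<bar>h (\<lambda>i. if i < k then x i else 0) - Re (p x)\<bar> \<le>
        e + 2 * B * indicator {x. \<exists>i<k. \<exists>b\<in>Basis. R < \<bar>x i \<bullet> b\<bar>} x"
proof -
  define S where "S = {y::nat \<Rightarrow> 'a. \<forall>i. y i \<in> (if i < k then cbox (-One) One else {0})}"
  define c where "c = pi / (2 * R)"
  have c: "0 < c" using R by (simp add: c_def)
  define s where "s x i = (if i < k then \<Sum>b\<in>Basis. sin (c * (x i \<bullet> b)) *\<^sub>R b else (0::'a))" for x i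
  define f where "f y = h (\<lambda>i. if i < k then \<Sum>b\<in>Basis. (arcsin (y i \<bullet> b) / c) *\<^sub>R b else 0)" for y
  have s_inner: "s x i \<bullet> b = sin (c * (x i \<bullet> b))" if "i < k" "b \<in> Basis" for x i b
    using that by (simp add: s_def inner_sum_left inner_Basis if_distrib cong: if_cong)
  have "continuous_on S f"
    unfolding f_def
  proof (rule continuous_on_compose2[OF h(1)])
    have *: "continuous_on S (\<lambda>y. y i)" for i :: nat
      by (rule continuous_on_subset[OF continuous_on_product_coordinates]) simp
    have "continuous_on S (\<lambda>y. \<Sum>b\<in>Basis. (arcsin (y i \<bullet> b) / c) *\<^sub>R b)" if "i < k" for i
    proof (intro continuous_intros *)
      show "\<forall>y\<in>S. - 1 \<le> y i \<bullet> b \<and> y i \<bullet> b \<le> 1" if b: "b \<in> Basis" for b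
      proof
        fix y assume "y \<in> S"
        then have "y i \<in> cbox (-One) One"
          using \<open>i < k\<close> unfolding S_def mem_Collect_eq by presburger
        then show "- 1 \<le> y i \<bullet> b \<and> y i \<bullet> b \<le> 1" using b by (auto simp: mem_box)
      qed
    qed (use c in auto)
    then show "continuous_on S (\<lambda>y i. if i < k then \<Sum>b\<in>Basis. (arcsin (y i \<bullet> b) / c) *\<^sub>R b else 0)"
      by (intro continuous_on_coordinatewise_then_product) (case_tac "i < k", auto)
  qed simp
  from trig_polys_dense[of k f, folded S_def, OF this e, of c] obtain g where
    g: "(\<lambda>x. complex_of_real (g (s x))) \<in> trig_polys k" "\<And>y. y \<in> S \<Longrightarrow> \<bar>f y - g y\<bar> < e"
    unfolding s_def by blast
  have sS: "s x \<in> S" for x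
  proof -
    have "s x i \<in> cbox (-One) One" if "i < k" for i
      using s_inner[OF that] by (auto simp: mem_box)
    then show ?thesis by (auto simp: S_def) (simp add: s_def)
  qed
  have eq: "f (s x) = h (\<lambda>i. if i < k then x i else 0)"
    if x: "\<not> (\<exists>i<k. \<exists>b\<in>Basis. R < \<bar>x i \<bullet> b\<bar>)" for x
  proof -
    have "(\<Sum>b\<in>Basis. (arcsin (s x i \<bullet> b) / c) *\<^sub>R b) = x i" if i: "i < k" for i
    proof -
      have "arcsin (s x i \<bullet> b) / c = x i \<bullet> b" if b: "b \<in> Basis" for b
      proof -
        have "\<bar>x i \<bullet> b\<bar> \<le> R" using x i b by (meson not_less)
        then have "\<bar>c * (x i \<bullet> b)\<bar> \<le> c * R" using c by (simp add: abs_mult)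
        also have "\<dots> = pi / 2" using R by (simp add: c_def)
        finally show ?thesis using s_inner[OF i b] c by (simp add: arcsin_sin abs_le_iff)
      qed
      then show ?thesis by (simp add: euclidean_representation)
    qed
    then show ?thesis unfolding f_def by (intro arg_cong[where f=h]) auto
  qed
  show ?thesis
  proof (rule that[OF g(1)])
    fix x :: "nat \<Rightarrow> 'a"
    \<comment> \<open>Both terms are values of \<open>h\<close>, whether or not x lies in the cube,
      so 2 B bounds their difference everywhere.\<close>
    have "\<bar>h (\<lambda>i. if i < k then x i else 0) - f (s x)\<bar> \<le> 2 * B"
      using h(2)[of "\<lambda>i. if i < k then x i else 0"]
        h(2)[of "\<lambda>i. if i < k then \<Sum>b\<in>Basis. (arcsin (s x i \<bullet> b) / c) *\<^sub>R b else 0"]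
      unfolding f_def by (auto simp: abs_le_iff)
    then show "\<bar>h (\<lambda>i. if i < k then x i else 0) - Re (complex_of_real (g (s x)))\<bar> \<le>
        e + 2 * B * indicator {x. \<exists>i<k. \<exists>b\<in>Basis. R < \<bar>x i \<bullet> b\<bar>} x"
      using g(2)[OF sS, of x] eq[of x] by (auto simp: indicator_def)
  qed
qed

text \<open>The approximation is good on the cube, and a union bound over the k * DIM('a) real
  coordinates controls the event of leaving it. The statement concerns one law, so that it applies
  to the approximating vectors as well as to the limit.\<close>

lemma expectation_trig_polys_approx:
  fixes h :: "(nat \<Rightarrow> 'a::euclidean_space) \<Rightarrow> real"
    and B e R d :: real and X :: "nat \<Rightarrow> 'w \<Rightarrow> 'a"
  assumes P: "prob_space P" and m [measurable]: "\<And>i. X i \<in> borel_measurable P"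
    and h: "continuous_on UNIV h" "\<And>x. \<bar>h x\<bar> \<le> B"
    and p: "p \<in> trig_polys k"
      "\<And>x. \<bar>h (\<lambda>i. if i < k then x i else 0) - Re (p x)\<bar> \<le>
        e + 2 * B * indicator {x. \<exists>i<k. \<exists>b\<in>Basis. R < \<bar>x i \<bullet> b\<bar>} x"
    and tail: "\<And>i b. i < k \<Longrightarrow> b \<in> Basis \<Longrightarrow>
      measure P {\<omega>\<in>space P. r i b < \<bar>X i \<omega> \<bullet> b\<bar>} \<le> d"
      "\<And>i b. i < k \<Longrightarrow> b \<in> Basis \<Longrightarrow> r i b \<le> R"
  shows "\<bar>(\<integral>\<omega>. h (\<lambda>i. if i < k then X i \<omega> else 0) \<partial>P) - Re (CLINT \<omega>|P. p (\<lambda>i. X i \<omega>))\<bar> \<le>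
    e + 2 * B * (k * DIM('a) * d)"
proof -
  interpret prob_space P by fact
  let ?A = "{\<omega>\<in>space P. \<exists>i<k. \<exists>b\<in>Basis. R < \<bar>X i \<omega> \<bullet> b\<bar>}"
  have [measurable]: "h \<in> borel_measurable borel"
    by (rule borel_measurable_continuous_onI[OF h(1)])
  have [measurable]: "(\<lambda>\<omega> i. if i < k then X i \<omega> else 0) \<in> borel_measurable P"
    by (rule measurable_coordinatewise_then_product) auto
  note ip = trig_polys_integrable[OF P m p(1)]
  have ih: "integrable P (\<lambda>\<omega>. h (\<lambda>i. if i < k then X i \<omega> else 0))"
    using h(2) by (intro integrable_const_bound[where B=B]) auto
  have B: "0 \<le> B" using h(2)[of undefined] by linarith
  have A: "measure P ?A \<le> k * DIM('a) * d"
  proof -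
    have "measure P ?A \<le> measure P (\<Union>z\<in>{..<k} \<times> Basis. {\<omega>\<in>space P. r (fst z) (snd z) < \<bar>X (fst z) \<omega> \<bullet> snd z\<bar>})"
    proof (rule finite_measure_mono)
      show "?A \<subseteq> (\<Union>z\<in>{..<k} \<times> Basis. {\<omega>\<in>space P. r (fst z) (snd z) < \<bar>X (fst z) \<omega> \<bullet> snd z\<bar>})"
      proof
        fix \<omega> assume "\<omega> \<in> ?A"
        then obtain i b where "\<omega> \<in> space P" "i < k" "b \<in> Basis" "R < \<bar>X i \<omega> \<bullet> b\<bar>" by auto
        then show "\<omega> \<in> (\<Union>z\<in>{..<k} \<times> Basis. {\<omega>\<in>space P. r (fst z) (snd z) < \<bar>X (fst z) \<omega> \<bullet> snd z\<bar>})"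
          using tail(2)[of i b] by (intro UN_I[of "(i, b)"]) auto
      qed
    qed (auto intro!: sets.finite_UN)
    also have "\<dots> \<le> (\<Sum>z\<in>{..<k} \<times> Basis. measure P {\<omega>\<in>space P. r (fst z) (snd z) < \<bar>X (fst z) \<omega> \<bullet> snd z\<bar>})"
      by (rule finite_measure_subadditive_finite) auto
    also have "\<dots> \<le> real (card ({..<k} \<times> (Basis::'a set))) * d"
      by (rule sum_bounded_above) (auto intro: tail(1))
    finally show ?thesis by (simp add: card_cartesian_product)
  qed
  have "(\<integral>\<omega>. h (\<lambda>i. if i < k then X i \<omega> else 0) \<partial>P) - Re (CLINT \<omega>|P. p (\<lambda>i. X i \<omega>)) =
    (\<integral>\<omega>. h (\<lambda>i. if i < k then X i \<omega> else 0) - Re (p (\<lambda>i. X i \<omega>)) \<partial>P)"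
    using ip ih by simp
  also have "\<bar>\<dots>\<bar> \<le> (\<integral>\<omega>. \<bar>h (\<lambda>i. if i < k then X i \<omega> else 0) - Re (p (\<lambda>i. X i \<omega>))\<bar> \<partial>P)"
    by (rule integral_abs_bound)
  also have "\<dots> \<le> (\<integral>\<omega>. e + 2 * B * indicator ?A \<omega> \<partial>P)"
  proof (rule integral_mono)
    show "integrable P (\<lambda>\<omega>. \<bar>h (\<lambda>i. if i < k then X i \<omega> else 0) - Re (p (\<lambda>i. X i \<omega>))\<bar>)"
      using ip ih by (intro integrable_abs Bochner_Integration.integrable_diff) auto
    show "integrable P (\<lambda>\<omega>. e + 2 * B * indicator ?A \<omega>)" by (auto simp: integrable_indicator_iff emeasure_eq_measure)
    show "\<bar>h (\<lambda>i. if i < k then X i \<omega> else 0) - Re (p (\<lambda>i. X i \<omega>))\<bar> \<le> e + 2 * B * indicator ?A \<omega>"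
      if "\<omega> \<in> space P" for \<omega>
      using p(2)[of "\<lambda>i. X i \<omega>"] that by (simp add: indicator_def)
  qed
  also have "\<dots> = e + 2 * B * measure P ?A"
    by (subst Bochner_Integration.integral_add) (auto simp: prob_space integrable_indicator_iff emeasure_eq_measure)
  also have "\<dots> \<le> e + 2 * B * (k * DIM('a) * d)"
    using A B by (intro add_left_mono mult_left_mono) auto
  finally show ?thesis .
qed

text \<open>The order of choices matters: a polynomial \<open>p\<close> is good only on a cube fixed
  beforehand, so the tails determine the cube first, \<open>p\<close> comes next, and only then n
  tends to infinity with \<open>p\<close> fixed.\<close>

lemma char_tendsto_imp_expectation_tendsto:
  fixes X :: "nat \<Rightarrow> nat \<Rightarrow> 'w \<Rightarrow> 'a::euclidean_space" and Y :: "nat \<Rightarrow> 'v \<Rightarrow> 'a"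
    and h :: "(nat \<Rightarrow> 'a) \<Rightarrow> real"
  assumes P: "\<And>n. prob_space (P n)" "prob_space Q"
    and m [measurable]: "\<And>n i. X n i \<in> borel_measurable (P n)" "\<And>i. Y i \<in> borel_measurable Q"
    and char: "\<And>u. (\<lambda>n. CLINT \<omega>|P n. iexp (\<Sum>i<k. u i \<bullet> X n i \<omega>)) \<longlonglongrightarrow>
       (CLINT \<omega>|Q. iexp (\<Sum>i<k. u i \<bullet> Y i \<omega>))"
    and h: "continuous_on UNIV h" "\<And>x. \<bar>h x\<bar> \<le> B"
  shows "(\<lambda>n. \<integral>\<omega>. h (\<lambda>i. if i < k then X n i \<omega> else 0) \<partial>P n) \<longlonglongrightarrow>
    (\<integral>\<omega>. h (\<lambda>i. if i < k then Y i \<omega> else 0) \<partial>Q)"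
proof (rule LIMSEQ_I)
  fix \<epsilon> :: real assume \<epsilon>: "0 < \<epsilon>"
  have B: "0 \<le> B" using h(2)[of undefined] by linarith
  \<comment> \<open>\<open>C * e\<close> is the whole error of replacing \<open>h\<close> by
    \<open>p\<close> when both accuracy and tail probabilities are \<open>e\<close>. It is made
    \<epsilon> / 4; there are two such replacements and one comparison of polynomial
    expectations.\<close>
  define C where "C = 1 + 2 * B * (k * DIM('a))"
  have C: "0 < C" using B unfolding C_def by (intro add_pos_nonneg) auto
  define e where "e = \<epsilon> / (4 * C)"
  have e: "0 < e" using \<epsilon> C by (simp add: e_def)
  \<comment> \<open>Thresholds depend on the coordinate, so they are collected into a function
    \<open>r\<close> by choice; its values for i \<ge> k are arbitrary and never consulted.\<close>
  define T where "T i b r \<longleftrightarrow> measure Q {\<omega>\<in>space Q. r < \<bar>Y i \<omega> \<bullet> b\<bar>} < e \<and>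
      (\<forall>\<^sub>F n in sequentially. measure (P n) {\<omega>\<in>space (P n). r < \<bar>X n i \<omega> \<bullet> b\<bar>} < e)" for i b r
  define r where "r i b = (SOME r. T i b r)" for i b
  have "\<exists>r. T i b r" if i: "i < k" for i b
    unfolding T_def
  proof (rule char_tendsto_imp_tails[OF P _ _ _ e, where X="\<lambda>n \<omega>. X n i \<omega> \<bullet> b" and Y="\<lambda>\<omega>. Y i \<omega> \<bullet> b"])
    \<comment> \<open>Joint frequencies concentrated in the single slot i and pointing along b give
      the one-dimensional characteristic functions.\<close>
    have *: "(\<Sum>j<k. (if j = i then t *\<^sub>R b else 0) \<bullet> x j) = t * (x i \<bullet> b)" for t and x :: "nat \<Rightarrow> 'a"
    proof -
      have "(\<Sum>j<k. (if j = i then t *\<^sub>R b else 0) \<bullet> x j) = (\<Sum>j<k. if j = i then t * (x j \<bullet> b) else 0)"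
        by (intro sum.cong) (auto simp: inner_commute)
      then show ?thesis using i by simp
    qed
    show "(\<lambda>n. CLINT \<omega>|P n. iexp (t * (X n i \<omega> \<bullet> b))) \<longlonglongrightarrow> (CLINT \<omega>|Q. iexp (t * (Y i \<omega> \<bullet> b)))" for t
      using char[of "\<lambda>j. if j = i then t *\<^sub>R b else 0"] unfolding * .
  qed auto
  from someI_ex[OF this] have "T i b (r i b)" if "i < k" for i b
    unfolding r_def using that by simp
  then have r: "\<And>i b. i < k \<Longrightarrow> measure Q {\<omega>\<in>space Q. r i b < \<bar>Y i \<omega> \<bullet> b\<bar>} < e"
    "\<And>i b. i < k \<Longrightarrow> \<forall>\<^sub>F n in sequentially. measure (P n) {\<omega>\<in>space (P n). r i b < \<bar>X n i \<omega> \<bullet> b\<bar>} < e"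
    unfolding T_def by blast+
  \<comment> \<open>The sum dominates every single threshold, and the added 1 keeps the cube
    nondegenerate.\<close>
  define R where "R = 1 + (\<Sum>i<k. \<Sum>b\<in>Basis. \<bar>r i b\<bar>)"
  have R: "0 < R" unfolding R_def by (intro add_pos_nonneg sum_nonneg) auto
  have rR: "r i b \<le> R" if "i < k" "b \<in> Basis" for i b
  proof -
    have "\<bar>r i b\<bar> \<le> (\<Sum>b\<in>Basis. \<bar>r i b\<bar>)" using that by (intro member_le_sum) auto
    also have "\<dots> \<le> (\<Sum>i<k. \<Sum>b\<in>Basis. \<bar>r i b\<bar>)"
      using that by (intro member_le_sum[of i]) (auto intro: sum_nonneg)
    finally show ?thesis by (simp add: R_def)
  qed
  obtain p where p: "p \<in> trig_polys k"
    "\<And>x. \<bar>h (\<lambda>i. if i < k then x i else 0) - Re (p x)\<bar> \<le>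
        e + 2 * B * indicator {x. \<exists>i<k. \<exists>b\<in>Basis. R < \<bar>x i \<bullet> b\<bar>} x"
    using trig_polys_approx[OF h e R, of k] by blast
  have Ce: "e + 2 * B * (k * DIM('a) * e) = \<epsilon> / 4"
  proof -
    have "e + 2 * B * (k * DIM('a) * e) = C * e" by (simp add: C_def algebra_simps)
    then show ?thesis using C by (simp add: e_def)
  qed
  let ?p = "\<lambda>n. Re (CLINT \<omega>|P n. p (\<lambda>i. X n i \<omega>))"
  have Q: "\<bar>(\<integral>\<omega>. h (\<lambda>i. if i < k then Y i \<omega> else 0) \<partial>Q) - Re (CLINT \<omega>|Q. p (\<lambda>i. Y i \<omega>))\<bar> \<le> \<epsilon> / 4"
    unfolding Ce[symmetric]
    by (rule expectation_trig_polys_approx[where P=Q and X=Y and h=h and B=B and p=p and k=k and e=e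
          and R=R and r=r and d=e, OF P(2) m(2) h p less_imp_le[OF r(1)] rR])
  have "\<forall>\<^sub>F n in sequentially. \<forall>i\<in>{..<k}. \<forall>b\<in>Basis. measure (P n) {\<omega>\<in>space (P n). r i b < \<bar>X n i \<omega> \<bullet> b\<bar>} < e"
    by (intro eventually_ball_finite ballI r(2)) auto
  then have Pn: "\<forall>\<^sub>F n in sequentially.
    \<bar>(\<integral>\<omega>. h (\<lambda>i. if i < k then X n i \<omega> else 0) \<partial>P n) - ?p n\<bar> \<le> \<epsilon> / 4"
  proof eventually_elim
    case (elim n)
    then show ?case
      unfolding Ce[symmetric]
      by (intro expectation_trig_polys_approx[where P="P n" and X="X n" and h=h and B=B and p=p and k=k
            and e=e and R=R and r=r and d=e, OF P(1) m(1) h p _ rR]) (auto intro: less_imp_le)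
  qed
  have "?p \<longlonglongrightarrow> Re (CLINT \<omega>|Q. p (\<lambda>i. Y i \<omega>))"
    by (rule tendsto_Re[OF trig_polys_integral_tendsto[where P=P and Q=Q and X=X and Y=Y and k=k, OF P m char p(1)]])
  then have "\<forall>\<^sub>F n in sequentially. \<bar>?p n - Re (CLINT \<omega>|Q. p (\<lambda>i. Y i \<omega>))\<bar> < \<epsilon> / 4"
    using \<epsilon> by (auto dest!: tendstoD[where e="\<epsilon>/4"] simp: dist_real_def)
  with Pn have "\<forall>\<^sub>F n in sequentially. norm ((\<integral>\<omega>. h (\<lambda>i. if i < k then X n i \<omega> else 0) \<partial>P n) -
     (\<integral>\<omega>. h (\<lambda>i. if i < k then Y i \<omega> else 0) \<partial>Q)) < \<epsilon>"
  proof eventually_elim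
    case (elim n)
    then show ?case using Q \<epsilon> unfolding real_norm_def by argo
  qed
  then show "\<exists>no. \<forall>n\<ge>no. norm ((\<integral>\<omega>. h (\<lambda>i. if i < k then X n i \<omega> else 0) \<partial>P n) -
     (\<integral>\<omega>. h (\<lambda>i. if i < k then Y i \<omega> else 0) \<partial>Q)) < \<epsilon>"
    by (simp add: eventually_sequentially)
qed

text \<open>Convergence from the right at 0 is tested along sequences of positive parameters, which
  reduces it to the sequential continuity theorem.\<close>

lemma fdd_convergeI_char:
  fixes X :: "real \<Rightarrow> 't \<Rightarrow> 'w \<Rightarrow> 'a::euclidean_space" and Y :: "'t \<Rightarrow> 'v \<Rightarrow> 'a"
  assumes P: "\<And>l. 0 < l \<Longrightarrow> prob_space (P l)" "prob_space Q"
    and m: "\<And>l t. 0 < l \<Longrightarrow> X l t \<in> borel_measurable (P l)" "\<And>t. Y t \<in> borel_measurable Q"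
    and char: "\<And>k t u. ((\<lambda>l. CLINT \<omega>|P l. iexp (\<Sum>i<k::nat. u i \<bullet> X l (t i) \<omega>)) \<longlongrightarrow>
       (CLINT \<omega>|Q. iexp (\<Sum>i<k. u i \<bullet> Y (t i) \<omega>))) (at_right 0)"
  shows "fdd_converge P X Q Y (at_right 0)"
  unfolding fdd_converge_def
proof (intro allI impI)
  fix k :: nat and t :: "nat \<Rightarrow> 't" and h :: "(nat \<Rightarrow> 'a) \<Rightarrow> real"
  assume h: "continuous_map (product_topology (\<lambda>_. euclidean) {..<k}) euclideanreal h"
    and bdd: "bounded (h ` ({..<k} \<rightarrow>\<^sub>E UNIV))"
  \<comment> \<open>The test function is given on the product over \<open>{..<k}\<close>;
    composition with restriction makes it continuous on the full function space, where the
    approximation takes place.\<close>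
  define h' where "h' x = h (restrict x {..<k})" for x
  have h': "continuous_on UNIV h'"
  proof -
    have "continuous_map (product_topology (\<lambda>_. euclidean) UNIV) (product_topology (\<lambda>_. euclidean) {..<k})
       (\<lambda>x::nat \<Rightarrow> 'a. restrict x {..<k})"
      by (auto simp: continuous_map_componentwise intro!: continuous_map_product_projection)
    from continuous_map_compose[OF this h] show ?thesis
      by (simp add: comp_def h'_def[abs_def] euclidean_product_topology)
  qed
  obtain B where B: "\<And>x. x \<in> {..<k} \<rightarrow>\<^sub>E UNIV \<Longrightarrow> \<bar>h x\<bar> \<le> B"
    using bdd by (auto simp: bounded_iff)
  have B': "\<bar>h' x\<bar> \<le> B" for x unfolding h'_def by (rule B) auto
  have eq: "h (\<lambda>i\<in>{..<k}. x i) = h' (\<lambda>i. if i < k then x i else 0)" for x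
    unfolding h'_def by (intro arg_cong[where f=h]) auto
  show "((\<lambda>l. \<integral>\<omega>. h (\<lambda>i\<in>{..<k}. X l (t i) \<omega>) \<partial>P l) \<longlongrightarrow>
           (\<integral>\<omega>. h (\<lambda>i\<in>{..<k}. Y (t i) \<omega>) \<partial>Q)) (at_right 0)"
    unfolding tendsto_at_iff_sequentially eq comp_def
  proof (intro allI impI)
    fix l :: "nat \<Rightarrow> real" assume l: "\<forall>i. l i \<in> {0<..} - {0}" "l \<longlonglongrightarrow> 0"
    show "(\<lambda>n. \<integral>\<omega>. h' (\<lambda>i. if i < k then X (l n) (t i) \<omega> else 0) \<partial>P (l n)) \<longlonglongrightarrow>
       (\<integral>\<omega>. h' (\<lambda>i. if i < k then Y (t i) \<omega> else 0) \<partial>Q)"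
    proof (rule char_tendsto_imp_expectation_tendsto[OF P(1) P(2) m(1) m(2) _ h' B', rotated -1])
      show "(\<lambda>n. CLINT \<omega>|P (l n). iexp (\<Sum>i<k. u i \<bullet> X (l n) (t i) \<omega>)) \<longlonglongrightarrow>
        (CLINT \<omega>|Q. iexp (\<Sum>i<k. u i \<bullet> Y (t i) \<omega>))" for u
        using char[where k=k and u=u and t=t] l unfolding tendsto_at_iff_sequentially comp_def by blast
    qed (use l in auto)
  qed
qed

section \<open>Convergence of stochastic integrals\<close>

lemma fdd_converge_stoch_integral:
  fixes \<sigma> :: "(real^'d) measure" and P :: "real \<Rightarrow> 'w measure"
    and M :: "real \<Rightarrow> (real^'n) set \<Rightarrow> 'w \<Rightarrow> real^'d"
    and f :: "'t \<Rightarrow> real^'n \<Rightarrow> real^'d^'d" and X :: "real \<Rightarrow> 't \<Rightarrow> 'w \<Rightarrow> real^'d"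
  assumes \<alpha>: "0 < \<alpha>" "\<alpha> < 2" and \<sigma>: "spectral_measure \<sigma>"
    and rm: "\<And>l. 0 \<le> l \<Longrightarrow> random_measure (P l) (levy_psi \<alpha> \<sigma> l) (M l)"
    and X: "\<And>l t. 0 \<le> l \<Longrightarrow> has_stoch_integral (P l) (M l) (f t) (X l t)"
  shows "fdd_converge P X (P 0) (X 0) (at_right 0)"
proof (rule fdd_convergeI_char)
  show "prob_space (P l)" if "0 < l" for l using that by (intro random_measure_prob_space[OF rm]) simp
  show "prob_space (P 0)" by (rule random_measure_prob_space[OF rm]) simp
  show "X l t \<in> borel_measurable (P l)" if "0 < l" for l t
    using X[of l t] that by (simp add: has_stoch_integral_def)
  show "X 0 t \<in> borel_measurable (P 0)" for t
    using X[of 0 t] by (simp add: has_stoch_integral_def)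
  fix k :: nat and t :: "nat \<Rightarrow> 't" and u :: "nat \<Rightarrow> real^'d"
  let ?g = "\<lambda>s. \<Sum>i<k. u i v* f (t i) s"
  have meas: "?g \<in> borel_measurable lborel"
  proof (rule vector_matrix_sum_measurable)
    show "f (t i) \<in> borel_measurable lborel" for i
      using X[of 0 "t i"] by (simp add: has_stoch_integral_def)
  qed
  have psi_meas: "(\<lambda>s. levy_psi \<alpha> \<sigma> l (?g s)) \<in> borel_measurable lborel" if "0 \<le> l" for l
  proof -
    have "levy_psi \<alpha> \<sigma> l \<in> borel_measurable borel"
      by (rule borel_measurable_continuous_onI[OF levy_psi_continuous[OF \<sigma> \<alpha> that]])
    with meas show ?thesis by simp
  qed
  have char: "integrable lborel (\<lambda>s. levy_psi \<alpha> \<sigma> l (?g s))" (is ?A)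
    "(CLINT \<omega>|P l. iexp (\<Sum>i<k. u i \<bullet> X l (t i) \<omega>)) =
       exp (complex_of_real (\<integral>s. levy_psi \<alpha> \<sigma> l (?g s) \<partial>lborel))" (is ?B) if l: "0 \<le> l" for l
  proof -
    show ?A
      by (rule stoch_integral_char(1)[where J="{..<k}" and f="\<lambda>i. f (t i)" and X="\<lambda>i. X l (t i)", OF rm[OF l]])
        (simp_all add: levy_psi_zero levy_psi_nonpos[OF \<sigma> \<alpha>] levy_psi_uminus
          levy_psi_continuous[OF \<sigma> \<alpha> l] levy_psi_diff_le[OF \<sigma> \<alpha> l, simplified] X[OF l])
    show ?B
      by (rule stoch_integral_char(2)[where J="{..<k}" and f="\<lambda>i. f (t i)" and X="\<lambda>i. X l (t i)", OF rm[OF l]])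
        (simp_all add: levy_psi_zero levy_psi_nonpos[OF \<sigma> \<alpha>] levy_psi_uminus
          levy_psi_continuous[OF \<sigma> \<alpha> l] levy_psi_diff_le[OF \<sigma> \<alpha> l, simplified] X[OF l])
  qed
  show "((\<lambda>l. CLINT \<omega>|P l. iexp (\<Sum>i<k. u i \<bullet> X l (t i) \<omega>)) \<longlongrightarrow>
       (CLINT \<omega>|P 0. iexp (\<Sum>i<k. u i \<bullet> X 0 (t i) \<omega>))) (at_right 0)"
    unfolding tendsto_at_iff_sequentially comp_def
  proof (intro allI impI)
    fix l :: "nat \<Rightarrow> real" assume l: "\<forall>i. l i \<in> {0<..} - {0}" "l \<longlonglongrightarrow> 0"
    then have l0: "0 \<le> l n" for n by (simp add: less_imp_le)
    \<comment> \<open>The majorant is integrable because the integrals for l = 0 exist: this is the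
      first conclusion of \<open>stoch_integral_char\<close> at l = 0.\<close>
    have "(\<lambda>n. \<integral>s. levy_psi \<alpha> \<sigma> (l n) (?g s) \<partial>lborel) \<longlonglongrightarrow> (\<integral>s. levy_psi \<alpha> \<sigma> 0 (?g s) \<partial>lborel)"
    proof (rule integral_dominated_convergence[where w="\<lambda>s. - levy_psi \<alpha> \<sigma> 0 (?g s)"])
      show "AE s in lborel. norm (levy_psi \<alpha> \<sigma> (l n) (?g s)) \<le> - levy_psi \<alpha> \<sigma> 0 (?g s)" for n
        using levy_psi_0_le[OF \<sigma> \<alpha> l0] levy_psi_nonpos[OF \<sigma> \<alpha>] by (intro AE_I2) (simp add: abs_of_nonpos)
      show "AE s in lborel. (\<lambda>n. levy_psi \<alpha> \<sigma> (l n) (?g s)) \<longlonglongrightarrow> levy_psi \<alpha> \<sigma> 0 (?g s)"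
        by (intro AE_I2 levy_psi_tendsto[OF \<sigma> \<alpha> l0 l(2)])
    qed (use char(1)[of 0] psi_meas l0 in auto)
    then show "(\<lambda>n. CLINT \<omega>|P (l n). iexp (\<Sum>i<k. u i \<bullet> X (l n) (t i) \<omega>)) \<longlonglongrightarrow>
       (CLINT \<omega>|P 0. iexp (\<Sum>i<k. u i \<bullet> X 0 (t i) \<omega>))"
      unfolding char(2)[OF l0] char(2)[OF order_refl] by (intro tendsto_intros)
  qed
qed

section \<open>Continuous images and real parts\<close>

lemma fdd_converge_compose:
  fixes c :: "'a::topological_space \<Rightarrow> 'b::topological_space"
  assumes X: "fdd_converge P X Q Y F" and c: "continuous_on UNIV c"
  shows "fdd_converge P (\<lambda>l t \<omega>. c (X l t \<omega>)) Q (\<lambda>t \<omega>. c (Y t \<omega>)) F"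
  unfolding fdd_converge_def
proof (intro allI impI)
  fix k :: nat and t and h :: "(nat \<Rightarrow> 'b) \<Rightarrow> real"
  assume h: "continuous_map (product_topology (\<lambda>_. euclidean) {..<k}) euclideanreal h"
    and bdd: "bounded (h ` ({..<k} \<rightarrow>\<^sub>E UNIV))"
  let ?h = "\<lambda>x. h (\<lambda>i\<in>{..<k}. c (x i))"
  have "continuous_map (product_topology (\<lambda>_. euclidean) {..<k}) (product_topology (\<lambda>_. euclidean) {..<k})
      (\<lambda>x. \<lambda>i\<in>{..<k}. c (x i))"
    unfolding continuous_map_componentwise
  proof (intro conjI ballI)
    fix i assume "i \<in> {..<k}"
    then have "continuous_map (product_topology (\<lambda>_. euclidean :: 'a topology) {..<k}) euclidean (\<lambda>x. c (x i))"
      using continuous_map_compose[OF continuous_map_product_projection, of i "{..<k}" "\<lambda>_. euclidean" euclidean c] c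
      by (simp add: comp_def)
    then show "continuous_map (product_topology (\<lambda>_. euclidean :: 'a topology) {..<k}) euclidean
      (\<lambda>x. (\<lambda>i\<in>{..<k}. c (x i)) i)"
      using \<open>i \<in> {..<k}\<close> by simp
  qed auto
  from continuous_map_compose[OF this h]
  have "continuous_map (product_topology (\<lambda>_. euclidean) {..<k}) euclideanreal ?h"
    by (simp add: comp_def)
  moreover have "bounded (?h ` ({..<k} \<rightarrow>\<^sub>E UNIV))"
    by (rule bounded_subset[OF bdd]) auto
  ultimately have "((\<lambda>l. \<integral>\<omega>. ?h (\<lambda>i\<in>{..<k}. X l (t i) \<omega>) \<partial>P l) \<longlongrightarrow>
      (\<integral>\<omega>. ?h (\<lambda>i\<in>{..<k}. Y (t i) \<omega>) \<partial>Q)) F"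
    using X unfolding fdd_converge_def by blast
  moreover have "(\<lambda>i\<in>{..<k}. c ((\<lambda>i\<in>{..<k}. x i) i)) = (\<lambda>i\<in>{..<k}. c (x i))" for x :: "nat \<Rightarrow> 'a"
    by auto
  ultimately show "((\<lambda>l. \<integral>\<omega>. h (\<lambda>i\<in>{..<k}. c (X l (t i) \<omega>)) \<partial>P l) \<longlongrightarrow>
      (\<integral>\<omega>. h (\<lambda>i\<in>{..<k}. c (Y (t i) \<omega>)) \<partial>Q)) F"
    by simp
qed

text \<open>Nothing is known about the processes for negative l, so an identity valid for l > 0 can
  be used only eventually along the filter.\<close>

lemma fdd_converge_cong:
  assumes "\<forall>\<^sub>F l in F. X l = X' l"
  shows "fdd_converge P X Q Y F \<longleftrightarrow> fdd_converge P X' Q Y F"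
proof -
  have "((\<lambda>l. \<integral>\<omega>. h (\<lambda>i\<in>{..<k}. X l (t i) \<omega>) \<partial>P l) \<longlongrightarrow> c) F \<longleftrightarrow>
     ((\<lambda>l. \<integral>\<omega>. h (\<lambda>i\<in>{..<k}. X' l (t i) \<omega>) \<partial>P l) \<longlongrightarrow> c) F" for h :: "_ \<Rightarrow> real" and k :: nat and t c
    by (rule tendsto_cong) (use assms in eventually_elim, simp)
  then show ?thesis unfolding fdd_converge_def by simp
qed

text \<open>The full integrals in dimension 2d have square matrix integrands and obey the real
  theorem. The projection to the first d coordinates is continuous and is applied only after the
  limit.\<close>

lemma fdd_converge_Re_stoch_integral:
  fixes \<sigma> :: "(real^('d::finite + 'd)) measure" and P :: "real \<Rightarrow> 'w measure"
    and MC :: "real \<Rightarrow> (real^'n) set \<Rightarrow> 'w \<Rightarrow> complex^'d"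
    and g :: "'t \<Rightarrow> real^'n \<Rightarrow> complex^'d^'d" and Y :: "real \<Rightarrow> 't \<Rightarrow> 'w \<Rightarrow> real^'d"
  assumes \<alpha>: "0 < \<alpha>" "\<alpha> < 2" and \<sigma>: "spectral_measure \<sigma>"
    and rm: "\<And>l. 0 \<le> l \<Longrightarrow> complex_random_measure (P l) (levy_psi \<alpha> \<sigma> l) (MC l)"
    and Y: "\<And>l t. 0 \<le> l \<Longrightarrow> has_Re_stoch_integral (P l) (MC l) (g t) (Y l t)"
  shows "fdd_converge P Y (P 0) (Y 0) (at_right 0)"
proof -
  define pr :: "real^('d + 'd) \<Rightarrow> real^'d" where "pr z = (\<chi> i. z $ Inl i)" for z
  define good where "good l t W \<longleftrightarrow>
    has_stoch_integral (P l) (\<lambda>A \<omega>. realify (MC l A \<omega>)) (\<lambda>s. block_mat (g t s)) W \<and>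
    Y l t = (\<lambda>\<omega>. pr (W \<omega>))" for l t W
  \<comment> \<open>The integral in dimension 2d occurs only existentially in
    \<open>has_Re_stoch_integral\<close>; a version is selected for each l and t to obtain a
    process.\<close>
  define Z where "Z l t = (SOME W. good l t W)" for l t
  have "good l t (Z l t)" if "0 \<le> l" for l t
  proof -
    have "\<exists>W. good l t W"
      using Y[OF that, of t] by (simp only: has_Re_stoch_integral_def good_def pr_def)
    then show ?thesis unfolding Z_def by (rule someI_ex)
  qed
  then have Z: "\<And>l t. 0 \<le> l \<Longrightarrow>
    has_stoch_integral (P l) (\<lambda>A \<omega>. realify (MC l A \<omega>)) (\<lambda>s. block_mat (g t s)) (Z l t)"
    "\<And>l t. 0 \<le> l \<Longrightarrow> Y l t = (\<lambda>\<omega>. pr (Z l t \<omega>))"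
    unfolding good_def by (blast, blast)
  have "fdd_converge P Z (P 0) (Z 0) (at_right 0)"
  proof (rule fdd_converge_stoch_integral[OF \<alpha> \<sigma>])
    show "random_measure (P l) (levy_psi \<alpha> \<sigma> l) (\<lambda>A \<omega>. realify (MC l A \<omega>))" if "0 \<le> l" for l
      using rm[OF that] unfolding complex_random_measure_def .
  qed (rule Z(1))
  moreover have "continuous_on UNIV pr"
    unfolding pr_def by (intro continuous_intros)
  ultimately have "fdd_converge P (\<lambda>l t \<omega>. pr (Z l t \<omega>)) (P 0) (\<lambda>t \<omega>. pr (Z 0 t \<omega>)) (at_right 0)"
    by (rule fdd_converge_compose)
  moreover have "\<forall>\<^sub>F l in at_right 0. Y l = (\<lambda>t \<omega>. pr (Z l t \<omega>))"
    using eventually_at_right_less[of 0] by (rule eventually_mono) (rule ext, rule Z(2), rule less_imp_le)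
  moreover have "Y 0 = (\<lambda>t \<omega>. pr (Z 0 t \<omega>))" by (rule ext, rule Z(2)) (rule order_refl)
  ultimately show ?thesis by (simp only: fdd_converge_cong)
qed

theorem lemma4p7:
  fixes \<alpha> \<beta> :: real
    and \<sigma> :: "(real^'d) measure" and \<sigma>' :: "(real^('d + 'd)) measure"
    and E :: "real^'n^'n" and N \<phi> :: "real^'n \<Rightarrow> real" and D :: "real^'d^'d"
    and P :: "real \<Rightarrow> 'w measure"
    and M :: "real \<Rightarrow> (real^'n) set \<Rightarrow> 'w \<Rightarrow> real^'d"
    and MC :: "real \<Rightarrow> (real^'n) set \<Rightarrow> 'w \<Rightarrow> complex^'d"
    and X Y :: "real \<Rightarrow> real^'n \<Rightarrow> 'w \<Rightarrow> real^'d"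
  assumes "0 < \<alpha>" and "\<alpha> < 2"
  shows
    "(spectral_measure \<sigma> \<and>
      (\<forall>l\<ge>0. random_measure (P l) (levy_psi \<alpha> \<sigma> l) (M l)) \<and>
      E \<in> matQ \<and> polar_norm E N \<and>
      (\<forall>x. 0 \<le> \<phi> x) \<and> homogeneous E \<phi> \<and> 0 < \<beta> \<and> admissible \<beta> E N \<phi> \<and>
      D \<in> matQ \<and> Max (Re ` eigvals D) < \<beta> \<and>
      (\<forall>l\<ge>0. \<forall>t. has_stoch_integral (P l) (M l) (ma_kernel \<alpha> E \<phi> D t) (X l t))
      \<longrightarrow> fdd_converge P X (P 0) (X 0) (at_right 0))
     \<and>
     (spectral_measure \<sigma>' \<and>
      (\<forall>l\<ge>0. complex_random_measure (P l) (levy_psi \<alpha> \<sigma>' l) (MC l)) \<and>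
      E \<in> matQ \<and>
      (\<forall>x. 0 \<le> \<phi> x) \<and> continuous_on UNIV \<phi> \<and> homogeneous (transpose E) \<phi> \<and>
      (\<forall>x. x \<noteq> 0 \<longrightarrow> 0 < \<phi> x) \<and>
      D \<in> matQ \<and> Max (Re ` eigvals D) < Min (Re ` eigvals E) \<and>
      (\<forall>l\<ge>0. \<forall>t. has_Re_stoch_integral (P l) (MC l) (harm_kernel \<alpha> E \<phi> D t) (Y l t))
      \<longrightarrow> fdd_converge P Y (P 0) (Y 0) (at_right 0))"
proof (intro conjI impI; elim conjE)
  assume "spectral_measure \<sigma>" "\<forall>l\<ge>0. random_measure (P l) (levy_psi \<alpha> \<sigma> l) (M l)"
    "\<forall>l\<ge>0. \<forall>t. has_stoch_integral (P l) (M l) (ma_kernel \<alpha> E \<phi> D t) (X l t)"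
  then show "fdd_converge P X (P 0) (X 0) (at_right 0)"
    by (intro fdd_converge_stoch_integral[OF assms, of \<sigma> P M "ma_kernel \<alpha> E \<phi> D" X]) blast+
next
  assume "spectral_measure \<sigma>'" "\<forall>l\<ge>0. complex_random_measure (P l) (levy_psi \<alpha> \<sigma>' l) (MC l)"
    "\<forall>l\<ge>0. \<forall>t. has_Re_stoch_integral (P l) (MC l) (harm_kernel \<alpha> E \<phi> D t) (Y l t)"
  then show "fdd_converge P Y (P 0) (Y 0) (at_right 0)"
    by (intro fdd_converge_Re_stoch_integral[OF assms, of \<sigma>' P MC "harm_kernel \<alpha> E \<phi> D" Y]) blast+
qed

end
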